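(* Let $g,\sigma,\ell>0$ and let $\gamma_\ast\in\mathbb{R}$ satisfy $|\gamma_\ast|/\sigma<1$. There exists a constant $M_{min}\ge 0$ such that if $M_{top}>M_{min}$, then, with $P_0=\frac{gM_{top}-2\gamma_\ast}{2\ell}$, there exists a unique $\zeta_0\in C^\infty([-\ell,\ell])$ solving $$\begin{cases} g\zeta_0-\sigma\mathcal{H}(\zeta_0)=P_0 & \text{on }(-\ell,\ell),\\ \sigma\,\dfrac{\zeta_0'}{\sqrt{1+|\zeta_0'|^2}}(\pm\ell)=\pm\gamma_\ast\end{cases}$$ and satisfying $\int_{-\ell}^{\ell}\zeta_0=M_{top}$. Moreover, $\min_{[-\ell,\ell]}\zeta_0>0$, and $\mathscr{I}(\zeta_0)\le\mathscr{I}(\psi)$ for all $\psi\in W^{1,1}((-\ell,\ell))$ such that $\int_{-\ell}^{\ell}\psi=M_{top}$.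
   Context: Here $g$ is the gravitational constant, $\sigma$ the surface tension coefficient, and $\gamma_\ast=\gamma_{sv}-\gamma_{sf}$ the difference of the solid-vapor and solid-fluid energies per unit length. The operator $\mathcal{H}$ is $$\mathcal{H}(\zeta)=\left(\frac{\zeta'}{\sqrt{1+|\zeta'|^2}}\right)',$$ and the energy functional $\mathscr{I}:W^{1,1}((-\ell,\ell))\to\mathbb{R}\cup\{+\infty\}$ is $$\mathscr{I}(\zeta)=\int_{-\ell}^{\ell}\left(\frac g2|\zeta|^2+\sigma\sqrt{1+|\zeta'|^2}\right)dx-\gamma_\ast\big(\zeta(\ell)+\zeta(-\ell)\big).$$ *)

theory Defs
  imports "HOL-Analysis.Analysis"
begin

text \<open>Derivative relative to \<open>S\<close>: on a nondegenerate compact interval it is the ordinary derivative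
  at interior points and the one-sided derivative at the endpoints.\<close>
definition deriv_on :: "real set \<Rightarrow> (real \<Rightarrow> real) \<Rightarrow> real \<Rightarrow> real" where
  "deriv_on S f x = vector_derivative f (at x within S)"

text \<open>For \<open>S = {a..b}\<close> with \<open>a < b\<close> this is \<open>C\<^sup>\<infinity>([a,b])\<close>, smoothness up to the boundary.  Values of
  \<open>f\<close> outside \<open>S\<close> play no role.\<close>
definition smooth_on :: "real set \<Rightarrow> (real \<Rightarrow> real) \<Rightarrow> bool" where
  "smooth_on S f \<longleftrightarrow> (\<forall>n. \<forall>x\<in>S. ((deriv_on S ^^ n) f) differentiable (at x within S))"

text \<open>The class \<open>C\<^sub>c\<^sup>\<infinity>(U)\<close>, each element extended by zero to the line.\<close>
definition test_function :: "real set \<Rightarrow> (real \<Rightarrow> real) \<Rightarrow> bool" where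
  "test_function U \<phi> \<longleftrightarrow> smooth_on UNIV \<phi> \<and>
     compact (closure {x. \<phi> x \<noteq> 0}) \<and> closure {x. \<phi> x \<noteq> 0} \<subseteq> U"

definition has_weak_deriv :: "real set \<Rightarrow> (real \<Rightarrow> real) \<Rightarrow> (real \<Rightarrow> real) \<Rightarrow> bool" where
  "has_weak_deriv U f f' \<longleftrightarrow> (\<forall>\<phi>. test_function U \<phi> \<longrightarrow>
     (LINT x:U|lebesgue. f x * deriv \<phi> x) = - (LINT x:U|lebesgue. f' x * \<phi> x))"

text \<open>Sobolev functions are represented by arbitrary functions on the line; only the almost
  everywhere class on \<open>U\<close> matters.\<close>
definition W11 :: "real set \<Rightarrow> (real \<Rightarrow> real) set" where
  "W11 U = {f. set_integrable lebesgue U f \<and>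
     (\<exists>f'. set_integrable lebesgue U f' \<and> has_weak_deriv U f f')}"

text \<open>Determined almost everywhere on open \<open>U\<close> whenever \<open>f \<in> W11 U\<close>.\<close>
definition weak_deriv :: "real set \<Rightarrow> (real \<Rightarrow> real) \<Rightarrow> real \<Rightarrow> real" where
  "weak_deriv U f = (SOME f'. set_integrable lebesgue U f' \<and> has_weak_deriv U f f')"

text \<open>The continuous representative on \<open>[a,b]\<close> of a function in \<open>W\<^sup>1\<^sup>,\<^sup>1((a,b))\<close>, unique on \<open>[a,b]\<close>; its
  endpoint values are the boundary traces.\<close>
definition cont_rep :: "real \<Rightarrow> real \<Rightarrow> (real \<Rightarrow> real) \<Rightarrow> real \<Rightarrow> real" where
  "cont_rep a b f = (SOME u. continuous_on {a..b} u \<and>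
     (AE x in lebesgue. x \<in> {a<..<b} \<longrightarrow> f x = u x))"

text \<open>The bulk integrand is nonnegative, so its integral is taken in \<open>[0,\<infinity>]\<close>.\<close>
definition energy :: "real \<Rightarrow> real \<Rightarrow> real \<Rightarrow> real \<Rightarrow> (real \<Rightarrow> real) \<Rightarrow> ereal" where
  "energy g \<sigma> \<gamma> l \<zeta> =
     enn2ereal (\<integral>\<^sup>+x\<in>{-l<..<l}.
        ennreal (g / 2 * \<bar>\<zeta> x\<bar>\<^sup>2 + \<sigma> * sqrt (1 + \<bar>weak_deriv {-l<..<l} \<zeta> x\<bar>\<^sup>2)) \<partial>lebesgue)
     - ereal (\<gamma> * (cont_rep (-l) l \<zeta> l + cont_rep (-l) l \<zeta> (-l)))"

definition unit_slope :: "real set \<Rightarrow> (real \<Rightarrow> real) \<Rightarrow> real \<Rightarrow> real" where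
  "unit_slope S \<zeta> x = deriv_on S \<zeta> x / sqrt (1 + \<bar>deriv_on S \<zeta> x\<bar>\<^sup>2)"

definition curvature_op :: "real set \<Rightarrow> (real \<Rightarrow> real) \<Rightarrow> real \<Rightarrow> real" where
  "curvature_op S \<zeta> = deriv_on S (unit_slope S \<zeta>)"

definition capillary_bvp ::
    "real \<Rightarrow> real \<Rightarrow> real \<Rightarrow> real \<Rightarrow> real \<Rightarrow> (real \<Rightarrow> real) \<Rightarrow> bool" where
  "capillary_bvp g \<sigma> \<gamma> l P \<zeta> \<longleftrightarrow>
     (\<forall>x\<in>{-l<..<l}. g * \<zeta> x - \<sigma> * curvature_op {-l..l} \<zeta> x = P) \<and>
     \<sigma> * unit_slope {-l..l} \<zeta> l = \<gamma> \<and>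
     \<sigma> * unit_slope {-l..l} \<zeta> (-l) = - \<gamma>"

end

theory Submission
  imports Defs
begin

text \<open>
  Write \<open>\<zeta> = \<eta> + P / g\<close>.  The constant pressure disappears, and with
  \<open>u = \<zeta>' / sqrt (1 + \<zeta>'\<^sup>2)\<close>, the sine of the inclination angle, the equation becomes the autonomous
  first order system \<open>\<eta>' = u / sqrt (1 - u\<^sup>2)\<close>, \<open>u' = (g / \<sigma>) \<eta>\<close> with \<open>u = \<plusminus>\<gamma> / \<sigma>\<close> at \<open>\<plusminus>l\<close>.
  It does not mention the mass: integrating \<open>g \<zeta> - \<sigma> u' = P\<close> shows that the prescribed value of \<open>P\<close>
  is exactly the one that gives total mass \<open>M\<close>.  So one profile \<open>\<eta>\<close> serves all masses, and
  positivity of the minimum holds as soon as the constant \<open>P / g\<close>, which grows with \<open>M\<close>, exceeds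
  \<open>- min \<eta>\<close>.

  For existence of the profile let \<open>\<gamma> > 0\<close> and \<open>s = \<gamma> / \<sigma>\<close>; negative \<open>\<gamma>\<close> follow by reflection.  The system
  conserves \<open>g / 2 \<eta>\<^sup>2 + \<sigma> sqrt (1 - u\<^sup>2)\<close>.  If \<open>a > 0\<close> denotes the height
  where \<open>u = 0\<close>, then \<open>\<eta>\<close> is an explicit function of \<open>u\<close> and \<open>a\<close>, and the position \<open>x\<close> is obtained from \<open>u\<close>
  by one integration.  The horizontal extent of the arc from \<open>u = -s\<close> to \<open>u = s\<close> tends to \<open>0\<close> as \<open>a\<close> grows
  and to infinity (logarithmically) as \<open>a\<close> tends to \<open>0\<close>, so some \<open>a\<close> gives extent \<open>2 l\<close>
  (\<open>ex_arc_of_length\<close>); inverting \<open>x(u)\<close> gives the solution (\<open>ex_arc_profile\<close>).  Together with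
  \<open>1 / sqrt (1 - u\<^sup>2)\<close> the pair \<open>(\<eta>, u)\<close> solves a polynomial system, whence smoothness up to the boundary.

  Solutions are unique: for two of them, \<open>(u1 - u2) (\<zeta>1 - \<zeta>2)\<close> vanishes at both ends and its derivative is
  at least \<open>(g / \<sigma>) (\<zeta>1 - \<zeta>2)\<^sup>2\<close>, because \<open>u\<close> is an increasing function of \<open>\<zeta>'\<close>
  (\<open>capillary_bvp_unique\<close>).

  Minimality is a matter of convexity.  The integrand is convex in \<open>(\<zeta>, \<zeta>')\<close>, so it lies above its tangent plane at \<open>\<zeta>\<close>.
  Integration by parts turns the linear part of the difference of the bulk integrals into \<open>P\<close> times the
  difference of the masses, which is zero, plus boundary terms that cancel the wetting energy
  (\<open>capillary_energy_minimal\<close>).  For a competitor that is only \<open>W\<^sup>1\<^sup>,\<^sup>1\<close> this needs that it agrees almost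
  everywhere with a constant plus the integral of its weak derivative (\<open>weak_deriv_primitive\<close>), which is
  the lemma of du Bois-Reymond, and integration by parts for such primitives, which is Fubini's theorem.
\<close>

section \<open>Finite orders of differentiability\<close>

text \<open>Recursion on the existence of some derivative avoids iterating the choice operator inside
  \<open>deriv_on\<close>, so that sums, products and solutions of differential equations are treated by plain
  induction on \<open>n\<close>.\<close>
primrec diff_times :: "real set \<Rightarrow> nat \<Rightarrow> (real \<Rightarrow> real) \<Rightarrow> bool" where
  "diff_times S 0 f \<longleftrightarrow> True"
| "diff_times S (Suc n) f \<longleftrightarrow>
     (\<exists>f'. (\<forall>x\<in>S. (f has_real_derivative f' x) (at x within S)) \<and> diff_times S n f')"

lemma diff_times_cong:
  assumes "\<And>x. x \<in> S \<Longrightarrow> f x = h x"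
  shows "diff_times S n f \<longleftrightarrow> diff_times S n h"
proof (cases n)
  case (Suc m)
  have "(f has_real_derivative D) (at x within S) \<longleftrightarrow> (h has_real_derivative D) (at x within S)"
    if "x \<in> S" for x D
    unfolding has_field_derivative_def
    using that assms has_derivative_transform[of x S] by metis
  then show ?thesis using Suc by auto
qed simp

lemma diff_times_lower: "diff_times S (Suc n) f \<Longrightarrow> diff_times S n f"
proof (induction n arbitrary: f)
  case (Suc n)
  then obtain f' where "\<forall>x\<in>S. (f has_real_derivative f' x) (at x within S)" "diff_times S (Suc n) f'"
    by auto
  with Suc.IH show ?case by auto
qed simp

lemma deriv_on_eq:
  assumes "at x within S \<noteq> bot" "(f has_real_derivative D) (at x within S)"
  shows "deriv_on S f x = D"
  unfolding deriv_on_def using assms vector_derivative_within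
  by (simp add: vector_derivative_within has_real_derivative_iff_has_vector_derivative)

lemma deriv_on_has_derivative:
  assumes "f differentiable (at x within S)"
  shows "(f has_real_derivative deriv_on S f x) (at x within S)"
  using assms unfolding deriv_on_def
  by (simp add: has_real_derivative_iff_has_vector_derivative vector_derivative_works)

text \<open>Where limits within \<open>S\<close> are nontrivial, derivatives within \<open>S\<close> are unique, so the chosen
  derivative \<open>deriv_on S f\<close> agrees on \<open>S\<close> with any other one.\<close>
lemma smooth_on_iff_diff_times:
  assumes nontriv: "\<And>x. x \<in> S \<Longrightarrow> at x within S \<noteq> bot"
  shows "smooth_on S f \<longleftrightarrow> (\<forall>n. diff_times S n f)"
proof
  have "diff_times S n f" if "\<forall>k. \<forall>x\<in>S. (deriv_on S ^^ k) f differentiable (at x within S)" for n f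
    using that
  proof (induction n arbitrary: f)
    case (Suc n)
    have "f differentiable (at x within S)" if "x \<in> S" for x
      using Suc.prems[rule_format, of x 0] that by simp
    moreover have "diff_times S n (deriv_on S f)"
      using Suc.prems by (intro Suc.IH) (metis funpow_Suc_right o_apply)
    ultimately show ?case by (auto intro: deriv_on_has_derivative)
  qed simp
  then show "smooth_on S f \<Longrightarrow> \<forall>n. diff_times S n f" by (simp add: smooth_on_def)
next
  have "\<forall>x\<in>S. (deriv_on S ^^ n) f differentiable (at x within S)" if "diff_times S (Suc n) f" for n f
    using that
  proof (induction n arbitrary: f)
    case 0
    then show ?case by (auto simp: real_differentiable_def)
  next
    case (Suc n)
    then obtain f' where f': "\<And>x. x \<in> S \<Longrightarrow> (f has_real_derivative f' x) (at x within S)"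
      and "diff_times S (Suc n) f'" by auto
    moreover have "deriv_on S f x = f' x" if "x \<in> S" for x
      using deriv_on_eq[OF nontriv f'] that by blast
    ultimately have "diff_times S (Suc n) (deriv_on S f)"
      using diff_times_cong[of S "deriv_on S f" f'] by blast
    from Suc.IH[OF this] show ?case by (simp only: funpow_Suc_right o_apply)
  qed
  then show "\<forall>n. diff_times S n f \<Longrightarrow> smooth_on S f" unfolding smooth_on_def by blast
qed

lemma diff_times_const: "diff_times S n (\<lambda>x. c)"
  by (induction n arbitrary: c) (auto intro!: exI[of _ "\<lambda>x. 0"])

lemma diff_times_add:
  "diff_times S n f \<Longrightarrow> diff_times S n h \<Longrightarrow> diff_times S n (\<lambda>x. f x + h x)"
proof (induction n arbitrary: f h)
  case (Suc n)
  then obtain f' h' where "\<forall>x\<in>S. (f has_real_derivative f' x) (at x within S)" "diff_times S n f'"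
    "\<forall>x\<in>S. (h has_real_derivative h' x) (at x within S)" "diff_times S n h'" by auto
  with Suc.IH show ?case by (auto intro!: exI[of _ "\<lambda>x. f' x + h' x"] DERIV_add)
qed simp

lemma diff_times_mult:
  "diff_times S n f \<Longrightarrow> diff_times S n h \<Longrightarrow> diff_times S n (\<lambda>x. f x * h x)"
proof (induction n arbitrary: f h)
  case (Suc n)
  then obtain f' h' where d: "\<forall>x\<in>S. (f has_real_derivative f' x) (at x within S)" "diff_times S n f'"
    "\<forall>x\<in>S. (h has_real_derivative h' x) (at x within S)" "diff_times S n h'" by auto
  have "diff_times S n f" "diff_times S n h" using Suc.prems by (blast intro: diff_times_lower)+
  then have "diff_times S n (\<lambda>x. f' x * h x + h' x * f x)"
    by (intro diff_times_add Suc.IH d)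
  then show ?case using d by (auto intro!: exI[of _ "\<lambda>x. f' x * h x + h' x * f x"] DERIV_mult)
qed simp

lemma diff_times_affine:
  "diff_times UNIV n f \<Longrightarrow> diff_times UNIV n (\<lambda>x. f (m * x + c))"
proof (induction n arbitrary: f)
  case (Suc n)
  then obtain f' where d: "\<And>x. (f has_real_derivative f' x) (at x)" "diff_times UNIV n f'" by auto
  have "((\<lambda>x. f (m * x + c)) has_real_derivative f' (m * x + c) * m) (at x)" for x
    by (rule DERIV_chain2[OF d(1)]) (auto intro!: derivative_eq_intros)
  moreover have "diff_times UNIV n (\<lambda>x. f' (m * x + c) * m)"
    by (rule diff_times_mult[OF Suc.IH[OF d(2)] diff_times_const])
  ultimately show ?case by (auto intro!: exI[of _ "\<lambda>x. f' (m * x + c) * m"])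
qed simp

section \<open>A flat function\<close>

text \<open>For \<open>m = 0\<close> this is the classical smooth function that vanishes to infinite order at \<open>0\<close>.  The
  factor \<open>inverse x ^ m\<close> makes the family closed under differentiation.\<close>
definition flat_exp :: "nat \<Rightarrow> real \<Rightarrow> real" where
  "flat_exp m x = (if x > 0 then exp (- inverse x) * inverse x ^ m else 0)"

lemma flat_exp_tendsto_0: "(flat_exp m \<longlongrightarrow> 0) (at 0)"
proof -
  have "((\<lambda>y. y ^ m / exp y) \<longlongrightarrow> (0::real)) at_top" for m :: nat
    by (rule tendsto_power_div_exp_0)
  then have "((\<lambda>x. inverse x ^ m / exp (inverse x)) \<longlongrightarrow> 0) (at_right (0::real))"
    by (rule filterlim_compose) (rule filterlim_inverse_at_top_right)
  then have "(flat_exp m \<longlongrightarrow> 0) (at_right 0)"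
    by (rule Lim_transform_eventually)
      (auto simp: flat_exp_def exp_minus divide_inverse eventually_at_filter)
  moreover have "(flat_exp m \<longlongrightarrow> 0) (at_left 0)"
    by (rule Lim_transform_eventually[of "\<lambda>x. 0"]) (auto simp: flat_exp_def eventually_at_filter)
  ultimately show ?thesis by (simp add: filterlim_split_at)
qed

text \<open>At the origin the difference quotient of \<open>flat_exp m\<close> is \<open>flat_exp (m + 1)\<close>, which tends to \<open>0\<close>.\<close>
lemma flat_exp_has_derivative:
  "(flat_exp m has_real_derivative flat_exp (m + 2) x - m * flat_exp (m + 1) x) (at x)"
proof -
  consider "x > 0" | "x < 0" | "x = 0" by linarith
  then show ?thesis
  proof cases
    case 1
    have "((\<lambda>x. inverse x ^ m) has_real_derivative
        of_nat m * (- (inverse x ^ Suc (Suc 0)) * inverse x ^ (m - Suc 0))) (at x)"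
      using DERIV_power[OF DERIV_inverse[of x], of m] 1 by simp
    also have "of_nat m * (- (inverse x ^ Suc (Suc 0)) * inverse x ^ (m - Suc 0))
        = - (m * inverse x ^ (m + 1))"
      by (cases m) (auto simp: algebra_simps)
    finally have p: "((\<lambda>x. inverse x ^ m) has_real_derivative - (m * inverse x ^ (m + 1))) (at x)" .
    have e: "((\<lambda>x. exp (- inverse x)) has_real_derivative exp (- inverse x) * inverse x ^ 2) (at x)"
      using 1 by (auto intro!: derivative_eq_intros simp: power2_eq_square)
    have "((\<lambda>x. exp (- inverse x) * inverse x ^ m) has_real_derivative
        exp (- inverse x) * inverse x ^ (m + 2) - m * (exp (- inverse x) * inverse x ^ (m + 1))) (at x)"
      using DERIV_mult[OF e p] by (simp add: algebra_simps power2_eq_square)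
    then have "((\<lambda>x. exp (- inverse x) * inverse x ^ m) has_real_derivative
        flat_exp (m + 2) x - m * flat_exp (m + 1) x) (at x)"
      using 1 by (simp add: flat_exp_def)
    then show ?thesis
      by (rule has_field_derivative_transform_within_open[of _ _ _ "{0<..}"])
        (use 1 in \<open>auto simp: flat_exp_def\<close>)
  next
    case 2
    have "((\<lambda>x. 0) has_real_derivative flat_exp (m + 2) x - m * flat_exp (m + 1) x) (at x)"
      using 2 by (simp add: flat_exp_def)
    then show ?thesis
      by (rule has_field_derivative_transform_within_open[of _ _ _ "{..<0}"])
        (use 2 in \<open>auto simp: flat_exp_def\<close>)
  next
    case 3
    have "((\<lambda>h. (flat_exp m (0 + h) - flat_exp m 0) / h) \<longlongrightarrow> 0) (at 0)"
      by (rule Lim_transform_eventually[OF flat_exp_tendsto_0[of "m + 1"]])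
        (auto simp: flat_exp_def eventually_at_filter field_simps)
    then show ?thesis using 3 by (simp add: DERIV_def flat_exp_def)
  qed
qed

lemma flat_exp_diff_times: "diff_times UNIV n (flat_exp m)"
proof (induction n arbitrary: m)
  case (Suc n)
  have "diff_times UNIV n (\<lambda>x. flat_exp (m + 2) x + (- real m) * flat_exp (m + 1) x)"
    by (intro diff_times_add diff_times_mult diff_times_const Suc.IH)
  then show ?case using flat_exp_has_derivative[of m] 
    by (auto intro!: exI[of _ "\<lambda>x. flat_exp (m + 2) x - m * flat_exp (m + 1) x"] simp del: One_nat_def)
qed simp

section \<open>The fundamental lemma of the calculus of variations\<close>

text \<open>The positive and negative parts of \<open>h\<close> are densities of two finite measures that agree on all
  half-lines, hence are equal.\<close>
lemma AE_zero_if_tail_integrals_zero: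
  fixes h :: "real \<Rightarrow> real"
  assumes h: "integrable lebesgue h" and tail: "\<And>x. (LINT t:{x<..}|lebesgue. h t) = 0"
  shows "AE x in lebesgue. h x = 0"
proof -
  \<comment> \<open>Half-lines generate the Borel sets only, so \<open>h\<close> is first replaced by a Borel representative.\<close>
  from h have "h \<in> borel_measurable lebesgue" by simp
  then obtain h' where h'[measurable]: "h' \<in> borel_measurable lborel" and "AE x in lborel. h x = h' x"
    using completion_ex_borel_measurable_real by blast
  then have hh': "AE x in lebesgue. h x = h' x" by (simp add: AE_completion)
  have h'leb[measurable]: "h' \<in> borel_measurable lebesgue" using h' by (rule measurable_completion)
  have "integrable lebesgue h'" using h hh' h'leb by (metis integrable_cong_AE_imp)
  then have int: "integrable lborel h'" using integrable_completion[OF h'] by simp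
  have tail': "(LINT t|lborel. indicator {x<..} t * h' t) = 0" for x
  proof -
    have "(LINT t|lborel. indicator {x<..} t * h' t) = (LINT t|lebesgue. indicator {x<..} t * h' t)"
      by (rule integral_completion[symmetric]) measurable
    also have "\<dots> = (LINT t|lebesgue. indicator {x<..} t * h t)"
      by (rule integral_cong_AE) (use h hh' in \<open>auto intro!: borel_measurable_times borel_measurable_indicator\<close>)
    finally show ?thesis using tail[of x] by (simp add: set_lebesgue_integral_def)
  qed
  define pos neg where "pos t = max 0 (h' t)" and "neg t = max 0 (- h' t)" for t
  have [measurable]: "pos \<in> borel_measurable lborel" "neg \<in> borel_measurable lborel"
    unfolding pos_def neg_def by measurable
  have ip: "integrable lborel pos" "integrable lborel neg"
    unfolding pos_def neg_def using int by auto
  have pn: "pos t \<ge> 0" "neg t \<ge> 0" for t by (auto simp: pos_def neg_def)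
  have em: "emeasure (density lborel (\<lambda>t. ennreal (f t))) {x<..} = ennreal (LINT t|lborel. indicator {x<..} t * f t)"
    if f: "integrable lborel f" "\<And>t. f t \<ge> 0" for f :: "real \<Rightarrow> real" and x
  proof -
    have "integrable lborel (\<lambda>t. indicator {x<..} t * f t)"
      using integrable_mult_indicator[of "{x<..}" lborel f] f by simp
    then have "ennreal (LINT t|lborel. indicator {x<..} t * f t) = (\<integral>\<^sup>+ t. ennreal (indicator {x<..} t * f t) \<partial>lborel)"
      using f(2) by (intro nn_integral_eq_integral[symmetric]) (auto simp: indicator_def)
    also have "\<dots> = (\<integral>\<^sup>+ t. ennreal (f t) * indicator {x<..} t \<partial>lborel)"
      by (intro nn_integral_cong) (auto simp: indicator_def)
    finally show ?thesis using f by (simp add: emeasure_density)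
  qed
  have "(LINT t|lborel. indicator {x<..} t * pos t) = (LINT t|lborel. indicator {x<..} t * neg t)" for x
  proof -
    have "(LINT t|lborel. indicator {x<..} t * pos t) - (LINT t|lborel. indicator {x<..} t * neg t)
       = (LINT t|lborel. indicator {x<..} t * pos t - indicator {x<..} t * neg t)"
      using integrable_mult_indicator[of "{x<..}" lborel pos] integrable_mult_indicator[of "{x<..}" lborel neg] ip
      by (intro Bochner_Integration.integral_diff[symmetric]) auto
    also have "\<dots> = (LINT t|lborel. indicator {x<..} t * h' t)"
      by (intro Bochner_Integration.integral_cong) (auto simp: pos_def neg_def max_def)
    finally show ?thesis using tail' by simp
  qed
  then have "density lborel (\<lambda>t. ennreal (pos t)) = density lborel (\<lambda>t. ennreal (neg t))"
    by (intro measure_eqI_lessThan) (auto simp: em[OF ip(1)] em[OF ip(2)] pn)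
  then have "AE t in lborel. ennreal (pos t) = ennreal (neg t)"
    by (intro sigma_finite_measure.density_unique[OF sigma_finite_lborel]) auto
  then have "AE t in lborel. h' t = 0"
    by eventually_elim (auto simp: pos_def neg_def max_def ennreal_eq_0_iff split: if_splits)
  then have "AE t in lebesgue. h' t = 0" by (rule AE_completion)
  with hh' show ?thesis by eventually_elim simp
qed

lemma test_function_interval_iff:
  "test_function {a<..<b} \<phi> \<longleftrightarrow>
     (\<forall>n. diff_times UNIV n \<phi>) \<and> (\<exists>c d. a < c \<and> d < b \<and> (\<forall>x. x \<notin> {c..d} \<longrightarrow> \<phi> x = 0))"
proof -
  let ?K = "closure {x. \<phi> x \<noteq> 0}"
  have "\<exists>c d. a < c \<and> d < b \<and> (\<forall>x. x \<notin> {c..d} \<longrightarrow> \<phi> x = 0)"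
    if K: "compact ?K" "?K \<subseteq> {a<..<b}"
  proof (cases "?K = {}")
    case True
    then have "\<phi> x = 0" for x using closure_subset[of "{x. \<phi> x \<noteq> 0}"] by blast
    then show ?thesis by (intro exI[of _ "a + 1"] exI[of _ "b - 1"]) auto
  next
    case False
    obtain c where c: "c \<in> ?K" "\<And>x. x \<in> ?K \<Longrightarrow> c \<le> x" using compact_attains_inf[OF K(1) False] by blast
    obtain d where d: "d \<in> ?K" "\<And>x. x \<in> ?K \<Longrightarrow> x \<le> d" using compact_attains_sup[OF K(1) False] by blast
    have "x \<in> ?K" if "\<phi> x \<noteq> 0" for x using that closure_subset[of "{x. \<phi> x \<noteq> 0}"] by blast
    then show ?thesis using c d K(2) by (metis atLeastAtMost_iff greaterThanLessThan_iff subsetD)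
  qed
  moreover have "compact ?K \<and> ?K \<subseteq> {a<..<b}"
    if "a < c" "d < b" "\<forall>x. x \<notin> {c..d} \<longrightarrow> \<phi> x = 0" for c d
  proof -
    have "?K \<subseteq> {c..d}" using that by (intro closure_minimal) auto
    then have "bounded ?K" using bounded_subset[OF bounded_closed_interval] by blast
    then show ?thesis using \<open>?K \<subseteq> {c..d}\<close> that
      by (auto simp: compact_eq_bounded_closed)
  qed
  ultimately show ?thesis
    unfolding test_function_def smooth_on_iff_diff_times[of UNIV, simplified] by blast
qed

text \<open>Steepening the arguments with \<open>n\<close> while shifting them by \<open>1\<close> has two effects: the support stays
  away from \<open>c\<close> and \<open>d\<close>, at distance \<open>1 / (n + 1)\<close>, and on the open interval both arguments tend to
  infinity, where \<open>flat_exp 0\<close> tends to \<open>1\<close>.\<close>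
definition bump :: "real \<Rightarrow> real \<Rightarrow> nat \<Rightarrow> real \<Rightarrow> real" where
  "bump c d n x = flat_exp 0 (real (Suc n) * (x - c) - 1) * flat_exp 0 (real (Suc n) * (d - x) - 1)"

lemma flat_exp_bounds: "0 \<le> flat_exp 0 x" "flat_exp 0 x \<le> 1"
  by (auto simp: flat_exp_def)

lemma bump_bounds: "0 \<le> bump c d n x" "bump c d n x \<le> 1"
  unfolding bump_def using flat_exp_bounds by (auto intro: mult_le_one)

lemma bump_test_function:
  assumes "a \<le> c" "d \<le> b"
  shows "test_function {a<..<b} (bump c d n)"
  unfolding test_function_interval_iff
proof safe
  fix k
  have "diff_times UNIV k (\<lambda>x. flat_exp 0 (real (Suc n) * x + (- real (Suc n) * c - 1)) *
      flat_exp 0 (- real (Suc n) * x + (real (Suc n) * d - 1)))"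
    by (intro diff_times_mult diff_times_affine flat_exp_diff_times)
  then show "diff_times UNIV k (bump c d n)" by (simp add: bump_def[abs_def] algebra_simps)
next
  let ?e = "1 / real (Suc n)"
  have "bump c d n x = 0" if "x \<notin> {c + ?e..d - ?e}" for x
  proof -
    from that consider "x < c + ?e" | "x > d - ?e" by force
    then show ?thesis
    proof cases
      case 1
      then have "real (Suc n) * (x - c) - 1 < 0" by (simp add: field_simps)
      then show ?thesis by (simp add: bump_def flat_exp_def)
    next
      case 2
      then have "real (Suc n) * (d - x) - 1 < 0" by (simp add: field_simps)
      then show ?thesis by (simp add: bump_def flat_exp_def)
    qed
  qed
  then show "\<exists>c' d'. a < c' \<and> d' < b \<and> (\<forall>x. x \<notin> {c'..d'} \<longrightarrow> bump c d n x = 0)"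
  proof (rule_tac exI[of _ "c + ?e"], rule_tac exI[of _ "d - ?e"], intro conjI)
    have "?e > 0" by simp
    then show "a < c + ?e" "d - ?e < b" using assms by linarith+
  qed auto
qed

lemma flat_exp_tendsto_1: "((flat_exp 0) \<longlongrightarrow> 1) at_top"
proof -
  have "((\<lambda>x::real. exp (- inverse x)) \<longlongrightarrow> exp (- 0)) at_top"
    by (intro tendsto_intros tendsto_inverse_0_at_top filterlim_ident)
  then have "((\<lambda>x::real. exp (- inverse x)) \<longlongrightarrow> 1) at_top" by simp
  then show ?thesis
    by (rule Lim_transform_eventually)
      (auto simp: flat_exp_def intro: eventually_mono[OF eventually_gt_at_top[of 0]])
qed

lemma bump_tendsto_indicator: "(\<lambda>n. bump c d n x) \<longlonglongrightarrow> indicator {c<..<d} x"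
proof (cases "x \<in> {c<..<d}")
  case True
  have lim: "filterlim (\<lambda>n. real (Suc n) * y - 1) at_top sequentially" if "y > 0" for y :: real
  proof -
    have "filterlim (\<lambda>n. y * real (Suc n)) at_top sequentially"
      by (rule filterlim_tendsto_pos_mult_at_top[OF tendsto_const that
            filterlim_compose[OF filterlim_real_sequentially filterlim_Suc]])
    from filterlim_tendsto_add_at_top[OF tendsto_const[of "-1"] this] show ?thesis
      by (simp add: algebra_simps)
  qed
  have "(\<lambda>n. bump c d n x) \<longlonglongrightarrow> 1 * 1" unfolding bump_def
    using True
    by (intro tendsto_mult filterlim_compose[OF flat_exp_tendsto_1] lim) auto
  with True show ?thesis by simp
next
  case False
  then consider "x \<le> c" | "x \<ge> d" by force
  then have "bump c d n x = 0" for n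
  proof cases
    case 1
    then have "real (Suc n) * (x - c) \<le> 0" by (intro mult_nonneg_nonpos) auto
    then show ?thesis by (simp add: bump_def flat_exp_def)
  next
    case 2
    then have "real (Suc n) * (d - x) \<le> 0" by (intro mult_nonneg_nonpos) auto
    then show ?thesis by (simp add: bump_def flat_exp_def)
  qed
  with False show ?thesis by simp
qed

lemma test_function_derivatives:
  assumes "test_function U \<phi>"
  shows "(\<phi> has_real_derivative deriv \<phi> x) (at x)" "continuous_on S \<phi>" "continuous_on S (deriv \<phi>)"
proof -
  have "smooth_on UNIV \<phi>" using assms by (simp add: test_function_def)
  then have "diff_times UNIV 2 \<phi>" using smooth_on_iff_diff_times[of UNIV \<phi>] by auto
  then obtain \<phi>' \<phi>'' where d: "\<And>x. (\<phi> has_real_derivative \<phi>' x) (at x)" 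
      "\<And>x. (\<phi>' has_real_derivative \<phi>'' x) (at x)"
    by (auto simp: numeral_2_eq_2)
  then have "deriv \<phi> = \<phi>'" by (auto intro: DERIV_imp_deriv)
  with d show "(\<phi> has_real_derivative deriv \<phi> x) (at x)" "continuous_on S \<phi>" "continuous_on S (deriv \<phi>)"
    by (auto intro!: DERIV_continuous_on intro: has_field_derivative_at_within)
qed

lemma test_function_boundary:
  assumes "test_function {a<..<b} \<phi>" shows "\<phi> a = 0" "\<phi> b = 0"
proof -
  obtain c d where cd: "a < c" "d < b" "\<forall>x. x \<notin> {c..d} \<longrightarrow> \<phi> x = 0"
    using assms by (auto simp: test_function_interval_iff)
  then show "\<phi> a = 0" "\<phi> b = 0" by auto
qed

lemma set_integrable_mult_continuous:
  fixes p u :: "real \<Rightarrow> real"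
  assumes p: "set_integrable lebesgue {a<..<b} p" and u: "continuous_on {a..b} u"
  shows "set_integrable lebesgue {a<..<b} (\<lambda>x. p x * u x)"
proof -
  have "(\<lambda>x. u x * p x) absolutely_integrable_on {a<..<b}"
  proof (rule absolutely_integrable_bounded_measurable_product_real[OF _ _ _ p])
    show "u \<in> borel_measurable (lebesgue_on {a<..<b})"
      by (rule continuous_imp_measurable_on_sets_lebesgue)
        (auto intro: continuous_on_subset[OF u])
    have "bounded (u ` {a..b})" by (intro compact_imp_bounded compact_continuous_image u) auto
    then show "bounded (u ` {a<..<b})" by (rule bounded_subset) auto
  qed auto
  then show ?thesis by (simp add: mult.commute)
qed

lemma set_integrable_continuous:
  fixes u :: "real \<Rightarrow> real"
  assumes "continuous_on {a..b} u" shows "set_integrable lebesgue {a<..<b} u"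
  by (rule set_integrable_subset[OF absolutely_integrable_continuous_real[OF assms]]) auto

text \<open>Testing with bumps that converge boundedly to the indicator function of an interval shows
  that all tail integrals of \<open>h\<close>, extended by zero, vanish.\<close>
lemma fundamental_lemma_calculus_of_variations:
  assumes h: "set_integrable lebesgue {a<..<b} h"
    and z: "\<And>\<phi>. test_function {a<..<b} \<phi> \<Longrightarrow> (LINT x:{a<..<b}|lebesgue. h x * \<phi> x) = 0"
  shows "AE x in lebesgue. x \<in> {a<..<b} \<longrightarrow> h x = 0"
proof -
  define H where "H x = indicator {a<..<b} x * h x" for x
  have H: "integrable lebesgue H" using h by (simp add: H_def[abs_def] set_integrable_def)
  then have Hm[measurable]: "H \<in> borel_measurable lebesgue" by simp
  have "(LINT t:{x<..}|lebesgue. H t) = 0" for x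
  proof -
    \<comment> \<open>For \<open>x \<ge> b\<close> the interval from \<open>c\<close> to \<open>b\<close> is empty and \<open>H\<close> vanishes beyond \<open>x\<close>.\<close>
    define c where "c = max a x"
    have test: "test_function {a<..<b} (bump c b n)" for n
      by (rule bump_test_function) (auto simp: c_def)
    have m[measurable]: "bump c b n \<in> borel_measurable lebesgue" for n
    proof -
      have "bump c b n \<in> borel_measurable borel"
        using test_function_derivatives(2)[OF test, of UNIV n] by (rule borel_measurable_continuous_onI)
      then show ?thesis by (simp add: measurable_completion)
    qed
    have "(\<lambda>n. LINT t|lebesgue. H t * bump c b n t) \<longlonglongrightarrow> (LINT t|lebesgue. H t * indicator {c<..<b} t)"
    proof (rule integral_dominated_convergence[where w = "\<lambda>t. norm (H t)"])
      show "AE t in lebesgue. (\<lambda>n. H t * bump c b n t) \<longlonglongrightarrow> H t * indicator {c<..<b} t"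
        by (auto intro!: tendsto_mult bump_tendsto_indicator)
      show "AE t in lebesgue. norm (H t * bump c b n t) \<le> norm (H t)" for n
        using bump_bounds[of c b n] by (auto simp: abs_mult intro!: mult_left_le)
    qed (use H in \<open>auto intro!: borel_measurable_times borel_measurable_indicator\<close>)
    moreover have "(LINT t|lebesgue. H t * bump c b n t) = 0" for n
      using z[OF test] by (simp add: H_def set_lebesgue_integral_def mult.assoc)
    ultimately have "(LINT t|lebesgue. H t * indicator {c<..<b} t) = 0"
      by (simp add: LIMSEQ_const_iff)
    moreover have "H t * indicator {c<..<b} t = indicator {x<..} t * H t" for t
      by (auto simp: H_def c_def indicator_def)
    ultimately show ?thesis by (simp add: set_lebesgue_integral_def)
  qed
  with H have "AE x in lebesgue. H x = 0" by (rule AE_zero_if_tail_integrals_zero)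
  then show ?thesis by eventually_elim (auto simp: H_def indicator_def split: if_splits)
qed


section \<open>Functions with an integrable weak derivative\<close>

text \<open>Vanishing total integral is what makes the primitive vanish to the right of the support of \<open>\<psi>\<close>.\<close>
lemma test_function_primitive:
  assumes test: "test_function {a<..<b} \<psi>" and zero: "(LINT x:{a<..<b}|lebesgue. \<psi> x) = 0"
  obtains \<phi> where "test_function {a<..<b} \<phi>" "deriv \<phi> = \<psi>"
proof -
  obtain c d where cd: "a < c" "d < b" and \<psi>0: "\<And>x. x \<notin> {c..d} \<Longrightarrow> \<psi> x = 0"
    using test by (auto simp: test_function_interval_iff)
  define \<phi> where "\<phi> x = integral {a..x} \<psi>" for x
  have cont: "continuous_on S \<psi>" for S using test_function_derivatives(2)[OF test] .
  have left: "\<phi> x = 0" if "x < c" for x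
  proof -
    have "integral {a..x} \<psi> = integral {a..x} (\<lambda>_. 0)"
      by (rule Henstock_Kurzweil_Integration.integral_cong) (use that \<psi>0 in auto)
    then show ?thesis by (simp add: \<phi>_def)
  qed
  have deriv: "(\<phi> has_real_derivative \<psi> x) (at x)" for x
  proof (cases "x < c")
    case True
    have "((\<lambda>x. 0) has_real_derivative \<psi> x) (at x)" using \<psi>0 True by simp
    then show ?thesis
      by (rule has_field_derivative_transform_within_open[of _ _ _ "{..<c}"]) (use True left in auto)
  next
    case False
    then have "a < x" using cd by simp
    have "(\<phi> has_real_derivative \<psi> x) (at x within {a..x + 1})"
      unfolding \<phi>_def by (rule integral_has_real_derivative[OF cont]) (use \<open>a < x\<close> in auto)
    moreover have "at x within {a..x + 1} = at x"
      by (rule at_within_interior) (use \<open>a < x\<close> in simp)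
    ultimately show ?thesis by simp
  qed
  have right: "\<phi> x = 0" if "x > d" for x
  proof -
    have "\<exists>k. \<forall>y\<in>{d<..}. \<phi> y = k"
    proof (rule has_field_derivative_zero_constant)
      show "(\<phi> has_real_derivative 0) (at y within {d<..})" if "y \<in> {d<..}" for y
        using has_field_derivative_at_within[OF deriv[of y]] \<psi>0[of y] that by simp
    qed (simp add: convex_real_interval)
    then have "\<phi> x = \<phi> b" using that cd by auto
    also have "\<dots> = (LINT x:{a<..<b}|lebesgue. \<psi> x)"
      unfolding \<phi>_def
      by (simp add: set_lebesgue_integral_eq_integral(2)[OF set_integrable_continuous[OF cont]] integral_open_interval_real)
    finally show ?thesis using zero by simp
  qed
  have "diff_times UNIV n \<phi>" for n
  proof (cases n)
    case (Suc m)
    then show ?thesis using deriv test by (auto simp: test_function_interval_iff)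
  qed simp
  then have "test_function {a<..<b} \<phi>"
    unfolding test_function_interval_iff using cd left right
    by (metis atLeastAtMost_iff not_le)
  moreover have "deriv \<phi> = \<psi>" using deriv by (auto intro: DERIV_imp_deriv)
  ultimately show ?thesis by (rule that)
qed

lemma not_AE_interval_zero:
  assumes "a < (b::real)" shows "\<not> (AE x in lebesgue. x \<notin> {a<..<b})"
proof
  assume "AE x in lebesgue. x \<notin> {a<..<b}"
  then have "negligible {a<..<b}" using AE_iff_null_sets[of "{a<..<b}" lebesgue]
    by (simp add: negligible_iff_null_sets)
  with assms show False using open_not_negligible[of "{a<..<b}"] by auto
qed

text \<open>Subtracting a multiple of a fixed test function \<open>\<rho>\<close> of nonzero integral makes the integral of any
  test function \<open>\<psi>\<close> vanish, so that the difference is the derivative of a test function.  The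
  hypothesis then says that \<open>h - C\<close> annihilates \<open>\<psi>\<close>, with \<open>C\<close> the \<open>\<rho>\<close>-average of \<open>h\<close>.\<close>
lemma du_bois_reymond:
  assumes "a < b" and h: "set_integrable lebesgue {a<..<b} h"
    and z: "\<And>\<phi>. test_function {a<..<b} \<phi> \<Longrightarrow> (LINT x:{a<..<b}|lebesgue. h x * deriv \<phi> x) = 0"
  shows "\<exists>C. AE x in lebesgue. x \<in> {a<..<b} \<longrightarrow> h x = C"
proof -
  let ?U = "{a<..<b}"
  have int1: "set_integrable lebesgue ?U (\<lambda>x. c)" for c :: real
    by (rule set_integrable_continuous) auto
  \<comment> \<open>If all test functions had integral zero, the fundamental lemma would make the constant \<open>1\<close> vanish.\<close>
  obtain \<rho> where \<rho>: "test_function ?U \<rho>" "(LINT x:?U|lebesgue. \<rho> x) \<noteq> 0"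
  proof -
    have False if "\<And>\<phi>. test_function ?U \<phi> \<Longrightarrow> (LINT x:?U|lebesgue. \<phi> x) = 0"
      using fundamental_lemma_calculus_of_variations[OF int1[of 1]] that not_AE_interval_zero[OF \<open>a < b\<close>] by simp
    then show ?thesis using that by blast
  qed
  have test_int: "set_integrable lebesgue ?U (\<lambda>x. f x * \<phi> x)"
    if "test_function ?U \<phi>" "set_integrable lebesgue ?U f" for \<phi> f
    by (rule set_integrable_mult_continuous[OF that(2) test_function_derivatives(2)[OF that(1)]])
  have test_int1: "set_integrable lebesgue ?U \<phi>" if "test_function ?U \<phi>" for \<phi>
    by (rule set_integrable_continuous[OF test_function_derivatives(2)[OF that]])
  define C where "C = (LINT x:?U|lebesgue. h x * \<rho> x) / (LINT x:?U|lebesgue. \<rho> x)"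
  have "(LINT x:?U|lebesgue. (h x - C) * \<psi> x) = 0" if \<psi>: "test_function ?U \<psi>" for \<psi>
  proof -
    define k where "k = (LINT x:?U|lebesgue. \<psi> x) / (LINT x:?U|lebesgue. \<rho> x)"
    define \<theta> where "\<theta> x = \<psi> x + (- k) * \<rho> x" for x
    have \<theta>: "test_function ?U \<theta>"
      unfolding test_function_interval_iff
    proof safe
      show "diff_times UNIV n \<theta>" for n
        unfolding \<theta>_def using \<psi> \<rho>
        by (intro diff_times_add diff_times_mult diff_times_const) (auto simp: test_function_interval_iff)
      obtain c d c' d' where cd: "a < c" "d < b" "\<forall>x. x \<notin> {c..d} \<longrightarrow> \<psi> x = 0"
        "a < c'" "d' < b" "\<forall>x. x \<notin> {c'..d'} \<longrightarrow> \<rho> x = 0"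
        using \<psi> \<rho>(1) unfolding test_function_interval_iff by blast
      have "\<theta> x = 0" if "x \<notin> {min c c'..max d d'}" for x
      proof -
        have "x \<notin> {c..d}" "x \<notin> {c'..d'}" using that by auto
        then have "\<psi> x = 0" "\<rho> x = 0" using cd by blast+
        then show ?thesis by (simp add: \<theta>_def)
      qed
      moreover have "a < min c c'" "max d d' < b" using cd by auto
      ultimately show "\<exists>c d. a < c \<and> d < b \<and> (\<forall>x. x \<notin> {c..d} \<longrightarrow> \<theta> x = 0)"
        by blast
    qed
    have "(LINT x:?U|lebesgue. \<theta> x) = (LINT x:?U|lebesgue. \<psi> x) + (- k) * (LINT x:?U|lebesgue. \<rho> x)"
      unfolding \<theta>_def using test_int1[OF \<psi>] test_int1[OF \<rho>(1)] by (simp add: set_integral_add set_integral_diff)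
    then have "(LINT x:?U|lebesgue. \<theta> x) = 0" using \<rho>(2) by (simp add: k_def)
    then obtain \<phi> where "test_function ?U \<phi>" "deriv \<phi> = \<theta>" using test_function_primitive[OF \<theta>] by blast
    then have 0: "(LINT x:?U|lebesgue. h x * \<theta> x) = 0" using z by blast
    have i: "set_integrable lebesgue ?U (\<lambda>x. h x * \<psi> x)" "set_integrable lebesgue ?U (\<lambda>x. h x * \<rho> x)"
      using test_int \<psi> \<rho>(1) h by auto
    have "(LINT x:?U|lebesgue. (h x - C) * \<psi> x)
        = (LINT x:?U|lebesgue. h x * \<psi> x) - C * (LINT x:?U|lebesgue. \<psi> x)"
      using i test_int1[OF \<psi>] by (simp add: left_diff_distrib set_integral_diff)
    also have "C * (LINT x:?U|lebesgue. \<psi> x) = k * (LINT x:?U|lebesgue. h x * \<rho> x)"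
      by (simp add: C_def k_def)
    also have "(LINT x:?U|lebesgue. h x * \<psi> x) - k * (LINT x:?U|lebesgue. h x * \<rho> x)
        = (LINT x:?U|lebesgue. h x * \<psi> x - k * (h x * \<rho> x))"
      using i by (simp add: set_integral_diff)
    also have "\<dots> = (LINT x:?U|lebesgue. h x * \<theta> x)"
      by (rule set_lebesgue_integral_cong) (auto simp: \<theta>_def algebra_simps)
    finally show ?thesis using 0 by simp
  qed
  then have "AE x in lebesgue. x \<in> ?U \<longrightarrow> h x - C = 0"
    by (intro fundamental_lemma_calculus_of_variations set_integral_diff h int1)
  then show ?thesis by auto
qed

lemma sigma_finite_lebesgue: "sigma_finite_measure (lebesgue :: real measure)"
proof
  obtain A :: "real set set" where "countable A" "A \<subseteq> sets lborel" "\<Union>A = space lborel"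
      "\<forall>a\<in>A. emeasure lborel a \<noteq> \<infinity>"
    using lborel.sigma_finite_countable by blast
  then show "\<exists>A. countable A \<and> A \<subseteq> sets lebesgue \<and> \<Union>A = space (lebesgue :: real measure) \<and>
      (\<forall>a\<in>A. emeasure lebesgue a \<noteq> \<infinity>)"
    by (intro exI[of _ A]) auto
qed

definition primitive :: "real \<Rightarrow> (real \<Rightarrow> real) \<Rightarrow> real \<Rightarrow> real" where
  "primitive a p x = (LINT t:{a<..<x}|lebesgue. p t)"

lemma primitive_continuous:
  assumes p: "set_integrable lebesgue {a<..<b} p"
  shows "continuous_on {a..b} (primitive a p)"
proof -
  have "p integrable_on {a..b}"
    using set_lebesgue_integral_eq_integral(1)[OF p] by (simp add: integrable_on_open_interval_real)
  moreover have "primitive a p x = integral {a..x} p" if "x \<in> {a..b}" for x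
    unfolding primitive_def integral_open_interval_real
    by (rule set_lebesgue_integral_eq_integral(2), rule set_integrable_subset[OF p]) (use that in auto)
  ultimately show ?thesis
    using indefinite_integral_continuous_1[of p a b] by (subst continuous_on_cong[OF refl]) auto
qed

lemma set_integral_FTC:
  fixes u :: "real \<Rightarrow> real"
  assumes "a \<le> b" and u: "\<And>x. x \<in> {a..b} \<Longrightarrow> (u has_real_derivative u' x) (at x within {a..b})"
    and u': "continuous_on {a..b} u'"
  shows "(LINT x:{a<..<b}|lebesgue. u' x) = u b - u a"
proof -
  have "(u' has_integral u b - u a) {a..b}"
    by (rule fundamental_theorem_of_calculus)
      (use assms in \<open>auto simp: has_real_derivative_iff_has_vector_derivative\<close>)
  then show ?thesis
    by (simp add: set_lebesgue_integral_eq_integral(2)[OF set_integrable_continuous[OF u']]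
      integral_open_interval_real[symmetric] integral_unique)
qed

text \<open>Both sides are iterated integrals of \<open>p(t) u'(x)\<close> over the triangle \<open>a < t < x < b\<close>.\<close>
lemma integral_by_parts_primitive:
  assumes "a \<le> b" and p: "set_integrable lebesgue {a<..<b} p"
    and u: "\<And>x. x \<in> {a..b} \<Longrightarrow> (u has_real_derivative u' x) (at x within {a..b})"
    and u': "continuous_on {a..b} u'"
  shows "(LINT x:{a<..<b}|lebesgue. primitive a p x * u' x)
    = u b * primitive a p b - (LINT x:{a<..<b}|lebesgue. p x * u x)"
proof -
  let ?U = "{a<..<b}"
  interpret L: sigma_finite_measure "lebesgue :: real measure" by (rule sigma_finite_lebesgue)
  interpret LL: pair_sigma_finite "lebesgue :: real measure" "lebesgue :: real measure" ..
  define P where "P t = indicator ?U t * p t" for t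
  define V where "V x = indicator ?U x * u' x" for x
  have P: "integrable lebesgue P" using p by (simp add: P_def[abs_def] set_integrable_def)
  have V: "integrable lebesgue V"
    using set_integrable_continuous[OF u'] by (simp add: V_def[abs_def] set_integrable_def)
  note [measurable] = borel_measurable_integrable[OF P] borel_measurable_integrable[OF V]
  have id[measurable]: "(\<lambda>x. x) \<in> borel_measurable (lebesgue :: real measure)"
    using measurable_completion[of "\<lambda>x::real. x" lborel borel] by simp
  have PV: "integrable (lebesgue \<Otimes>\<^sub>M lebesgue) (\<lambda>(x, t). V x * P t)"
    using P V by (intro LL.Fubini_integrable) (auto simp: abs_mult)
  define K where "K x t = (if t < x then V x * P t else 0)" for x t
  have K: "integrable (lebesgue \<Otimes>\<^sub>M lebesgue) (case_prod K)"
  proof (rule Bochner_Integration.integrable_bound[OF PV])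
    have "(\<lambda>z. K (fst z) (snd z)) \<in> borel_measurable (lebesgue \<Otimes>\<^sub>M lebesgue)"
      unfolding K_def by measurable
    then show "case_prod K \<in> borel_measurable (lebesgue \<Otimes>\<^sub>M lebesgue)" by (simp add: split_beta')
  qed (auto simp: K_def)
  have inner1: "(LINT t|lebesgue. K x t) = indicator ?U x * (primitive a p x * u' x)" for x
  proof (cases "x \<in> ?U")
    case True
    have "(LINT t|lebesgue. K x t) = (LINT t|lebesgue. u' x * (indicator {a<..<x} t * p t))"
      by (rule Bochner_Integration.integral_cong) (use True in \<open>auto simp: K_def V_def P_def indicator_def\<close>)
    then show ?thesis using True by (simp add: primitive_def set_lebesgue_integral_def)
  qed (simp add: K_def V_def cong: if_cong)
  have inner2: "(LINT x|lebesgue. K x t) = indicator ?U t * (p t * (u b - u t))" for t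
  proof (cases "t \<in> ?U")
    case True
    have "(LINT x|lebesgue. K x t) = (LINT x|lebesgue. p t * (indicator {t<..<b} x * u' x))"
      by (rule Bochner_Integration.integral_cong) (use True in \<open>auto simp: K_def V_def P_def indicator_def\<close>)
    also have "\<dots> = p t * (LINT x:{t<..<b}|lebesgue. u' x)"
      by (simp add: set_lebesgue_integral_def)
    also have "(LINT x:{t<..<b}|lebesgue. u' x) = u b - u t"
      by (rule set_integral_FTC)
        (use True in \<open>auto intro: has_field_derivative_subset[OF u] continuous_on_subset[OF u']\<close>)
    finally show ?thesis using True by simp
  qed (simp add: K_def P_def cong: if_cong)
  have pu: "set_integrable lebesgue ?U (\<lambda>x. p x * u x)"
    by (rule set_integrable_mult_continuous[OF p]) (rule DERIV_continuous_on[OF u])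
  have "(LINT x:?U|lebesgue. primitive a p x * u' x) = (LINT x|lebesgue. LINT t|lebesgue. K x t)"
    by (simp add: inner1 set_lebesgue_integral_def)
  also have "\<dots> = (LINT t|lebesgue. LINT x|lebesgue. K x t)"
    by (rule LL.Fubini_integral[OF K, symmetric])
  also have "\<dots> = (LINT t:?U|lebesgue. p t * u b - p t * u t)"
    by (simp add: inner2 set_lebesgue_integral_def right_diff_distrib)
  also have "\<dots> = primitive a p b * u b - (LINT t:?U|lebesgue. p t * u t)"
    using p pu by (simp add: set_integral_diff primitive_def)
  finally show ?thesis by simp
qed


text \<open>The primitive of \<open>p\<close> has weak derivative \<open>p\<close> as well, so the difference \<open>f - primitive a p\<close> is
  orthogonal to all derivatives of test functions.\<close>
lemma weak_deriv_primitive: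
  assumes "a < b" and f: "set_integrable lebesgue {a<..<b} f" and p: "set_integrable lebesgue {a<..<b} p"
    and fp: "has_weak_deriv {a<..<b} f p"
  shows "\<exists>C. AE x in lebesgue. x \<in> {a<..<b} \<longrightarrow> f x = C + primitive a p x"
proof -
  let ?U = "{a<..<b}"
  have cP: "continuous_on {a..b} (primitive a p)" by (rule primitive_continuous[OF p])
  have "(LINT x:?U|lebesgue. (f x - primitive a p x) * deriv \<phi> x) = 0" if \<phi>: "test_function ?U \<phi>" for \<phi>
  proof -
    note d = test_function_derivatives[OF \<phi>]
    have "(LINT x:?U|lebesgue. (f x - primitive a p x) * deriv \<phi> x)
        = (LINT x:?U|lebesgue. f x * deriv \<phi> x) - (LINT x:?U|lebesgue. primitive a p x * deriv \<phi> x)"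
      using set_integrable_mult_continuous[OF f d(3)]
        set_integrable_mult_continuous[OF set_integrable_continuous[OF cP] d(3)]
      by (simp add: left_diff_distrib set_integral_diff)
    also have "(LINT x:?U|lebesgue. f x * deriv \<phi> x) = - (LINT x:?U|lebesgue. p x * \<phi> x)"
      using fp \<phi> by (simp add: has_weak_deriv_def)
    also have "(LINT x:?U|lebesgue. primitive a p x * deriv \<phi> x) = - (LINT x:?U|lebesgue. p x * \<phi> x)"
      using integral_by_parts_primitive[OF less_imp_le[OF \<open>a < b\<close>] p has_field_derivative_at_within[OF d(1)] d(3)]
        test_function_boundary[OF \<phi>] by simp
    finally show ?thesis by simp
  qed
  then obtain C where "AE x in lebesgue. x \<in> ?U \<longrightarrow> f x - primitive a p x = C"
    using du_bois_reymond[OF \<open>a < b\<close> set_integral_diff(1)[OF f set_integrable_continuous[OF cP]]] by blast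
  then have "AE x in lebesgue. x \<in> ?U \<longrightarrow> f x = C + primitive a p x"
    by eventually_elim auto
  then show ?thesis ..
qed

lemma weak_deriv_unique:
  assumes p: "set_integrable lebesgue {a<..<b} p" "has_weak_deriv {a<..<b} f p"
    and q: "set_integrable lebesgue {a<..<b} q" "has_weak_deriv {a<..<b} f q"
  shows "AE x in lebesgue. x \<in> {a<..<b} \<longrightarrow> p x = q x"
proof -
  have "(LINT x:{a<..<b}|lebesgue. (p x - q x) * \<phi> x) = 0" if \<phi>: "test_function {a<..<b} \<phi>" for \<phi>
    using p(2) q(2) \<phi> set_integrable_mult_continuous[OF p(1) test_function_derivatives(2)[OF \<phi>]]
      set_integrable_mult_continuous[OF q(1) test_function_derivatives(2)[OF \<phi>]]
    by (simp add: has_weak_deriv_def left_diff_distrib set_integral_diff)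
  then have "AE x in lebesgue. x \<in> {a<..<b} \<longrightarrow> p x - q x = 0"
    by (intro fundamental_lemma_calculus_of_variations set_integral_diff(1) p(1) q(1))
  then show ?thesis by simp
qed

lemma has_weak_deriv_C1:
  assumes "a < b" and z: "\<And>x. x \<in> {a..b} \<Longrightarrow> (z has_real_derivative z' x) (at x within {a..b})"
    and z': "continuous_on {a..b} z'"
  shows "has_weak_deriv {a<..<b} z z'"
  unfolding has_weak_deriv_def
proof safe
  let ?U = "{a<..<b}"
  fix \<phi> assume \<phi>: "test_function ?U \<phi>"
  note d = test_function_derivatives[OF \<phi>]
  have zz: "z x = primitive a z' x + z a" if "x \<in> ?U" for x
    unfolding primitive_def
    by (subst set_integral_FTC[of a x z z'])
      (use that in \<open>auto intro: has_field_derivative_subset[OF z] continuous_on_subset[OF z']\<close>)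
  have i: "set_integrable lebesgue ?U z'" by (rule set_integrable_continuous[OF z'])
  have "(LINT x:?U|lebesgue. z x * deriv \<phi> x)
      = (LINT x:?U|lebesgue. primitive a z' x * deriv \<phi> x + z a * deriv \<phi> x)"
    by (rule set_lebesgue_integral_cong) (auto simp: zz algebra_simps)
  also have "\<dots> = (LINT x:?U|lebesgue. primitive a z' x * deriv \<phi> x) + z a * (LINT x:?U|lebesgue. deriv \<phi> x)"
    using set_integrable_mult_continuous[OF set_integrable_continuous[OF primitive_continuous[OF i]] d(3)]
      set_integrable_continuous[OF d(3)]
    by (simp add: set_integral_add)
  also have "(LINT x:?U|lebesgue. deriv \<phi> x) = 0"
    using set_integral_FTC[of a b \<phi> "deriv \<phi>"] d \<open>a < b\<close> test_function_boundary[OF \<phi>]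
    by (simp add: has_field_derivative_at_within)
  also have "(LINT x:?U|lebesgue. primitive a z' x * deriv \<phi> x) = - (LINT x:?U|lebesgue. z' x * \<phi> x)"
    using integral_by_parts_primitive[OF less_imp_le[OF \<open>a < b\<close>] i has_field_derivative_at_within[OF d(1)] d(3)]
      test_function_boundary[OF \<phi>] by simp
  finally show "(LINT x:?U|lebesgue. z x * deriv \<phi> x) = - (LINT x:?U|lebesgue. z' x * \<phi> x)" by simp
qed

text \<open>The set where two continuous functions differ is open, and nonempty open sets are not negligible.\<close>
lemma continuous_AE_eq:
  fixes u v :: "real \<Rightarrow> real"
  assumes "a < b" and u: "continuous_on {a..b} u" and v: "continuous_on {a..b} v"
    and ae: "AE x in lebesgue. x \<in> {a<..<b} \<longrightarrow> u x = v x" and "x \<in> {a..b}"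
  shows "u x = v x"
proof -
  let ?D = "{x \<in> {a<..<b}. u x - v x \<in> - {0}}"
  have c: "continuous_on {a..b} (\<lambda>x. u x - v x)" by (intro continuous_intros u v)
  have "open ?D"
    using continuous_open_preimage[of "{a<..<b}" "\<lambda>x. u x - v x" "- {0}"] continuous_on_subset[OF c, of "{a<..<b}"]
      open_Compl[OF closed_singleton, of "0::real"]
    by (simp add: vimage_def Int_def subset_eq)
  then have "?D \<in> sets lebesgue" by auto
  moreover have "AE x in lebesgue. x \<notin> ?D" using ae by eventually_elim auto
  ultimately have "negligible ?D"
    using AE_iff_null_sets[of ?D lebesgue] by (simp add: negligible_iff_null_sets)
  with \<open>open ?D\<close> have "?D = {}" using open_not_negligible by blast
  then have "u x - v x = 0" if "x \<in> {a<..<b}" for x using that by auto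
  moreover have "closure {a<..<b} = {a..b}" using \<open>a < b\<close> by simp
  ultimately have "u x - v x = 0"
    using continuous_constant_on_closure[of "{a<..<b}" "\<lambda>x. u x - v x" 0 x] c \<open>x \<in> {a..b}\<close> by auto
  then show ?thesis by simp
qed

lemma cont_rep_eq:
  assumes "a < b" and u: "continuous_on {a..b} u"
    and ae: "AE x in lebesgue. x \<in> {a<..<b} \<longrightarrow> f x = u x" and "x \<in> {a..b}"
  shows "cont_rep a b f x = u x"
proof -
  have "continuous_on {a..b} (cont_rep a b f) \<and> (AE x in lebesgue. x \<in> {a<..<b} \<longrightarrow> f x = cont_rep a b f x)"
    unfolding cont_rep_def by (rule someI[of _ u]) (use u ae in simp)
  then have c: "continuous_on {a..b} (cont_rep a b f)"
    and "AE x in lebesgue. x \<in> {a<..<b} \<longrightarrow> f x = cont_rep a b f x" by auto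
  then have "AE x in lebesgue. x \<in> {a<..<b} \<longrightarrow> cont_rep a b f x = u x"
    using ae by eventually_elim auto
  then show ?thesis using continuous_AE_eq[OF \<open>a < b\<close> c u] \<open>x \<in> {a..b}\<close> by blast
qed

lemma W11_representation:
  assumes "a < b" and f: "f \<in> W11 {a<..<b}"
  obtains C where "set_integrable lebesgue {a<..<b} (weak_deriv {a<..<b} f)"
    "has_weak_deriv {a<..<b} f (weak_deriv {a<..<b} f)"
    "AE x in lebesgue. x \<in> {a<..<b} \<longrightarrow> f x = C + primitive a (weak_deriv {a<..<b} f) x"
proof -
  let ?p = "weak_deriv {a<..<b} f"
  have p: "set_integrable lebesgue {a<..<b} ?p \<and> has_weak_deriv {a<..<b} f ?p"
    unfolding weak_deriv_def
    by (rule someI_ex[of "\<lambda>f'. set_integrable lebesgue {a<..<b} f' \<and> has_weak_deriv {a<..<b} f f'"])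
      (use f in \<open>auto simp: W11_def\<close>)
  moreover from p have "\<exists>C. AE x in lebesgue. x \<in> {a<..<b} \<longrightarrow> f x = C + primitive a ?p x"
    using weak_deriv_primitive[OF \<open>a < b\<close>, of f] f by (auto simp: W11_def)
  ultimately show ?thesis using that by blast
qed

text \<open>The bulk integrand is dominated by \<open>g / 2 v\<^sup>2 + \<sigma> (1 + \<bar>p\<bar>)\<close> with \<open>v\<close> bounded, so the energy is finite
  and becomes an ordinary integral, in which representatives of \<open>f\<close> and of its weak derivative may be
  chosen freely.\<close>
lemma energy_eq:
  assumes "g > 0" "\<sigma> > 0" "l > 0" and v: "continuous_on {-l..l} v"
    and fv: "AE x in lebesgue. x \<in> {-l<..<l} \<longrightarrow> f x = v x"
    and p: "set_integrable lebesgue {-l<..<l} p" "AE x in lebesgue. x \<in> {-l<..<l} \<longrightarrow> weak_deriv {-l<..<l} f x = p x"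
  shows "set_integrable lebesgue {-l<..<l} (\<lambda>x. g / 2 * (v x)\<^sup>2 + \<sigma> * sqrt (1 + (p x)\<^sup>2))" (is "set_integrable _ _ ?E")
    and "energy g \<sigma> \<gamma> l f =
      ereal ((LINT x:{-l<..<l}|lebesgue. g / 2 * (v x)\<^sup>2 + \<sigma> * sqrt (1 + (p x)\<^sup>2)) - \<gamma> * (v l + v (-l)))"
proof -
  let ?U = "{-l<..<l}"
  have pm: "(\<lambda>x. indicator ?U x * p x) \<in> borel_measurable lebesgue"
    using p(1) by (auto simp: set_integrable_def)
  have "set_integrable lebesgue ?U (\<lambda>x. sqrt (1 + (p x)\<^sup>2))"
  proof (rule set_integrable_bound[where f = "\<lambda>x. 1 + \<bar>p x\<bar>"])
    show "set_integrable lebesgue ?U (\<lambda>x. 1 + \<bar>p x\<bar>)"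
      by (intro set_integral_add set_integrable_abs p(1) set_integrable_continuous[of "-l" l]) auto
    have "(\<lambda>x. indicator ?U x *\<^sub>R sqrt (1 + (p x)\<^sup>2))
        = (\<lambda>x. indicator ?U x * sqrt (1 + (indicator ?U x * p x)\<^sup>2))"
      by (auto simp: indicator_def)
    also have "\<dots> \<in> borel_measurable lebesgue"
      using pm by (intro borel_measurable_times borel_measurable_indicator borel_measurable_sqrt
          borel_measurable_add borel_measurable_power) auto
    finally show "set_borel_measurable lebesgue ?U (\<lambda>x. sqrt (1 + (p x)\<^sup>2))"
      by (simp add: set_borel_measurable_def)
    have "sqrt (1 + (p x)\<^sup>2) \<le> 1 + \<bar>p x\<bar>" for x
      by (rule real_le_lsqrt) (auto simp: power2_eq_square algebra_simps)
    then show "AE x in lebesgue. x \<in> ?U \<longrightarrow> norm (sqrt (1 + (p x)\<^sup>2)) \<le> norm (1 + \<bar>p x\<bar>)"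
      by (auto simp: abs_of_nonneg)
  qed
  moreover have "set_integrable lebesgue ?U (\<lambda>x. (v x)\<^sup>2)"
    by (intro set_integrable_continuous continuous_intros v)
  ultimately show int: "set_integrable lebesgue ?U ?E"
    by (intro set_integral_add set_integrable_mult_right) auto
  have E0: "?E x \<ge> 0" for x using assms by auto
  have "(\<integral>\<^sup>+x\<in>?U. ennreal (g / 2 * \<bar>f x\<bar>\<^sup>2 + \<sigma> * sqrt (1 + \<bar>weak_deriv ?U f x\<bar>\<^sup>2)) \<partial>lebesgue)
      = (\<integral>\<^sup>+x. ennreal (indicator ?U x *\<^sub>R ?E x) \<partial>lebesgue)"
  proof (rule nn_integral_cong_AE)
    show "AE x in lebesgue. ennreal (g / 2 * \<bar>f x\<bar>\<^sup>2 + \<sigma> * sqrt (1 + \<bar>weak_deriv ?U f x\<bar>\<^sup>2)) * indicator ?U x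
        = ennreal (indicator ?U x *\<^sub>R ?E x)"
      using fv p(2) by eventually_elim (auto simp: indicator_def)
  qed
  also have "\<dots> = ennreal (LINT x:?U|lebesgue. ?E x)"
    unfolding set_lebesgue_integral_def
    by (rule nn_integral_eq_integral) (use int E0 in \<open>auto simp: set_integrable_def indicator_def\<close>)
  finally have bulk: "(\<integral>\<^sup>+x\<in>?U. ennreal (g / 2 * \<bar>f x\<bar>\<^sup>2 + \<sigma> * sqrt (1 + \<bar>weak_deriv ?U f x\<bar>\<^sup>2)) \<partial>lebesgue)
      = ennreal (LINT x:?U|lebesgue. ?E x)" .
  have "(LINT x:?U|lebesgue. ?E x) \<ge> 0"
    unfolding set_lebesgue_integral_def by (rule integral_nonneg_AE) (use E0 in \<open>auto simp: indicator_def\<close>)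
  moreover have "cont_rep (-l) l f x = v x" if "x \<in> {-l..l}" for x
    by (rule cont_rep_eq[OF _ v fv that]) (use \<open>l > 0\<close> in simp)
  ultimately show "energy g \<sigma> \<gamma> l f = ereal ((LINT x:?U|lebesgue. ?E x) - \<gamma> * (v l + v (-l)))"
    unfolding energy_def bulk using \<open>l > 0\<close> by (simp add: enn2ereal_ennreal)
qed

section \<open>Existence of the profile\<close>

text \<open>Conservation of \<open>k / 2 \<eta>\<^sup>2 + sqrt (1 - u\<^sup>2)\<close> along \<open>\<eta>' = u / sqrt (1 - u\<^sup>2)\<close>, \<open>u' = k \<eta>\<close> determines
  the height \<open>\<eta>\<close> at slope \<open>u = v\<close> from the height \<open>a\<close> at slope \<open>0\<close>.\<close>
definition arc_height :: "real \<Rightarrow> real \<Rightarrow> real \<Rightarrow> real" where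
  "arc_height k a v = sqrt (a\<^sup>2 + 2 / k * (1 - sqrt (1 - v\<^sup>2)))"

lemma sqrt_one_minus_bounds:
  assumes "\<bar>v\<bar> < (1::real)"
  shows "0 < 1 - v\<^sup>2" "0 < sqrt (1 - v\<^sup>2)" "sqrt (1 - v\<^sup>2) \<le> 1" "1 - v\<^sup>2 \<le> sqrt (1 - v\<^sup>2)"
proof -
  show p: "0 < 1 - v\<^sup>2" using assms by (simp add: abs_square_less_1)
  then show "0 < sqrt (1 - v\<^sup>2)" "sqrt (1 - v\<^sup>2) \<le> 1" by (auto simp: real_le_lsqrt)
  show "1 - v\<^sup>2 \<le> sqrt (1 - v\<^sup>2)"
  proof (rule real_le_rsqrt)
    have "(1 - v\<^sup>2) * (1 - v\<^sup>2) \<le> (1 - v\<^sup>2) * 1" using p by (intro mult_left_mono) auto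
    then show "(1 - v\<^sup>2)\<^sup>2 \<le> 1 - v\<^sup>2" by (simp add: power2_eq_square)
  qed
qed

lemma arc_height_bounds:
  assumes "k > 0" "a > 0" "\<bar>v\<bar> < 1"
  shows "a \<le> arc_height k a v" "arc_height k a v \<le> a + sqrt (2 / k) * \<bar>v\<bar>"
proof -
  note b = sqrt_one_minus_bounds[OF assms(3)]
  show "a \<le> arc_height k a v"
    unfolding arc_height_def by (rule real_le_rsqrt) (use assms b in auto)
  show "arc_height k a v \<le> a + sqrt (2 / k) * \<bar>v\<bar>"
    unfolding arc_height_def
  proof (rule real_le_lsqrt)
    have "2 / k * (1 - sqrt (1 - v\<^sup>2)) \<le> 2 / k * v\<^sup>2"
      using assms b by (intro mult_left_mono) auto
    also have "\<dots> = (sqrt (2 / k) * \<bar>v\<bar>)\<^sup>2" using assms by (simp add: power_mult_distrib)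
    also have "a\<^sup>2 + (sqrt (2 / k) * \<bar>v\<bar>)\<^sup>2 \<le> (a + sqrt (2 / k) * \<bar>v\<bar>)\<^sup>2"
      using assms by (simp add: power2_sum)
    finally show "a\<^sup>2 + 2 / k * (1 - sqrt (1 - v\<^sup>2)) \<le> (a + sqrt (2 / k) * \<bar>v\<bar>)\<^sup>2" by simp
  qed (use assms in simp)
qed

lemma arc_height_pos: "k > 0 \<Longrightarrow> a > 0 \<Longrightarrow> \<bar>v\<bar> < 1 \<Longrightarrow> arc_height k a v > 0"
  using arc_height_bounds(1)[of k a v] by linarith

lemma arc_height_continuous:
  "continuous_on S (\<lambda>z. arc_height k (fst z) (snd z))"
  unfolding arc_height_def by (intro continuous_intros)

lemma arc_height_has_derivative:
  assumes "k > 0" "a > 0" "\<bar>v\<bar> < 1"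
  shows "(arc_height k a has_real_derivative v / sqrt (1 - v\<^sup>2) / (k * arc_height k a v)) (at v)"
proof -
  note b = sqrt_one_minus_bounds[OF assms(3)]
  have "a\<^sup>2 + 2 / k * (1 - sqrt (1 - v\<^sup>2)) > 0"
    using assms b by (intro add_pos_nonneg mult_nonneg_nonneg) auto
  then show ?thesis
    unfolding arc_height_def[abs_def] using b assms
    by (auto intro!: derivative_eq_intros simp: field_simps)
qed

text \<open>Since \<open>dx / du = 1 / (k \<eta>)\<close>, the integral is the horizontal extent of the arc.  It is at most
  \<open>2 s / (k a)\<close>, and by the upper bound \<open>a + sqrt (2 / k) \<bar>v\<bar>\<close> for the height it is at least
  \<open>ln (1 + sqrt (2 / k) s / a) / (k sqrt (2 / k))\<close>; at the two heights tested
  below the extent is therefore at most and at least \<open>2 L\<close>, and continuity in \<open>a\<close> does the rest.\<close>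
lemma ex_arc_of_length:
  assumes "k > 0" "0 < s" "s < 1" "L > 0"
  obtains a where "a > 0" "integral {-s..s} (\<lambda>v. 1 / (k * arc_height k a v)) = 2 * L"
proof -
  define Y where "Y a = integral {-s..s} (\<lambda>v. 1 / (k * arc_height k a v))" for a
  have cv: "continuous_on {-s..s} (\<lambda>v. 1 / (k * arc_height k a v))" if "a > 0" for a
  proof -
    have "continuous_on {-s..s} (arc_height k a)" unfolding arc_height_def by (intro continuous_intros)
    moreover have "\<forall>v\<in>{-s..s}. k * arc_height k a v \<noteq> 0"
    proof
      fix v assume "v \<in> {-s..s}"
      then have "\<bar>v\<bar> < 1" using assms by auto
      then show "k * arc_height k a v \<noteq> 0"
        using arc_height_pos[OF assms(1) that, of v] assms by auto
    qed
    ultimately show ?thesis by (intro continuous_intros)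
  qed
  have contY: "continuous_on {0<..} Y"
    unfolding Y_def
  proof (rule integral_continuous_on_param[of _ "-s" s, unfolded cbox_interval])
    show "continuous_on ({0<..} \<times> {-s..s}) (\<lambda>(a, v). 1 / (k * arc_height k a v))"
      unfolding split_beta'
    proof (intro continuous_intros arc_height_continuous ballI)
      fix z :: "real \<times> real" assume z: "z \<in> {0<..} \<times> {-s..s}"
      then have "\<bar>snd z\<bar> < 1" using assms by (auto simp: mem_Times_iff)
      then show "k * arc_height k (fst z) (snd z) \<noteq> 0"
        using arc_height_pos[OF assms(1), of "fst z" "snd z"] z assms by (auto simp: mem_Times_iff)
    qed
  qed
  have "Y (s / (k * L)) \<le> 2 * L"
  proof -
    let ?a = "s / (k * L)"
    have a: "?a > 0" using assms by simp
    have "Y ?a \<le> integral {-s..s} (\<lambda>v. L / s)"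
      unfolding Y_def
    proof (rule integral_le)
      show "1 / (k * arc_height k ?a v) \<le> L / s" if "v \<in> {-s..s}" for v
      proof -
        have "?a \<le> arc_height k ?a v" using arc_height_bounds(1)[OF assms(1) a] that assms by auto
        then have "k * ?a \<le> k * arc_height k ?a v" by (rule mult_left_mono) (use assms in simp)
        then have "1 / (k * arc_height k ?a v) \<le> 1 / (k * ?a)"
          using a assms arc_height_pos[OF assms(1) a, of v] that
          by (intro divide_left_mono mult_pos_pos) auto
        also have "\<dots> = L / s" using assms by simp
        finally show ?thesis .
      qed
    qed (use integrable_continuous_real[OF cv[OF a]] in auto)
    then show ?thesis using assms by simp
  qed
  moreover have "2 * L \<le> Y (sqrt (2 / k) * s / exp (2 * L * k * sqrt (2 / k)))"
  proof -
    define c where "c = sqrt (2 / k)"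
    have c: "c > 0" using assms by (simp add: c_def)
    define a where "a = c * s / exp (2 * L * k * c)"
    have a: "a > 0" using assms c by (simp add: a_def)
    have acs: "a + c * s > 0" using a c assms by (simp add: add_pos_pos)
    have "((\<lambda>v. 1 / (k * (a + c * v))) has_integral (ln (a + c * s) / (k * c) - ln (a + c * 0) / (k * c))) {0..s}"
    proof (rule fundamental_theorem_of_calculus)
      fix v assume v: "v \<in> {0..s}"
      have "a + c * v > 0" using v a c by (auto intro: add_pos_nonneg)
      then have "((\<lambda>v. ln (a + c * v) / (k * c)) has_real_derivative (c / (a + c * v)) / (k * c)) (at v within {0..s})"
        by (intro DERIV_cdivide) (auto intro!: derivative_eq_intros)
      then show "((\<lambda>v. ln (a + c * v) / (k * c)) has_vector_derivative 1 / (k * (a + c * v))) (at v within {0..s})"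
        using c by (simp add: has_real_derivative_iff_has_vector_derivative mult.commute)
    qed (use assms in simp)
    then have low: "((\<lambda>v. 1 / (k * (a + c * v))) has_integral (ln ((a + c * s) / a) / (k * c))) {0..s}"
      using a acs by (simp add: ln_div diff_divide_distrib)
    have "exp (2 * L * k * c) \<le> (a + c * s) / a"
      using a c assms by (simp add: a_def field_simps)
    then have "2 * L * k * c \<le> ln ((a + c * s) / a)"
      using a c assms by (subst ln_ge_iff) (auto intro!: divide_pos_pos add_pos_pos)
    then have "2 * L \<le> ln ((a + c * s) / a) / (k * c)"
      using c assms by (simp add: pos_le_divide_eq mult.assoc)
    also have "\<dots> = integral {0..s} (\<lambda>v. 1 / (k * (a + c * v)))" using low by (simp add: integral_unique)
    also have "\<dots> \<le> integral {0..s} (\<lambda>v. 1 / (k * arc_height k a v))"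
    proof (rule integral_le)
      show "1 / (k * (a + c * v)) \<le> 1 / (k * arc_height k a v)" if "v \<in> {0..s}" for v
      proof -
        have v: "\<bar>v\<bar> < 1" using that assms by auto
        have "arc_height k a v \<le> a + c * v" using arc_height_bounds(2)[OF assms(1) a v] that by (simp add: c_def)
        then show ?thesis using arc_height_pos[OF assms(1) a v] assms
          by (intro divide_left_mono mult_left_mono mult_pos_pos) auto
      qed
    qed (use low integrable_on_subinterval[OF integrable_continuous_real[OF cv[OF a]]] assms in auto)
    also have "\<dots> \<le> Y a"
      unfolding Y_def
    proof (rule integral_subset_le)
      show "\<forall>v\<in>{-s..s}. 0 \<le> 1 / (k * arc_height k a v)"
      proof
        fix v assume "v \<in> {-s..s}"
        then have "\<bar>v\<bar> < 1" using assms by auto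
        then show "0 \<le> 1 / (k * arc_height k a v)"
          using arc_height_pos[OF assms(1) a, of v] assms by simp
      qed
    qed (use integrable_on_subinterval[OF integrable_continuous_real[OF cv[OF a]]] assms in auto)
    finally show ?thesis unfolding a_def c_def .
  qed
  moreover have "connected (Y ` {0<..})" by (intro connected_continuous_image contY) auto
  ultimately have "2 * L \<in> Y ` {0<..}"
    using connectedD_interval[of "Y ` {0<..}" "Y (s / (k * L))" "Y (sqrt (2 / k) * s / exp (2 * L * k * sqrt (2 / k)))" "2 * L"]
      assms by auto
  then show ?thesis using that unfolding Y_def by auto
qed


text \<open>The position \<open>T\<close> as a function of the slope \<open>v\<close> is an integral, and \<open>u\<close> is its inverse.\<close>
lemma ex_arc_profile_pos:
  assumes "k > 0" "0 < s" "s < 1" "L > 0"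
  obtains \<eta> u where
    "\<And>x. x \<in> {-L..L} \<Longrightarrow> (\<eta> has_real_derivative u x / sqrt (1 - (u x)\<^sup>2)) (at x)"
    "\<And>x. x \<in> {-L..L} \<Longrightarrow> (u has_real_derivative k * \<eta> x) (at x)"
    "\<And>x. x \<in> {-L..L} \<Longrightarrow> \<bar>u x\<bar> < 1" "u L = s" "u (-L) = -s"
proof -
  obtain a where a: "a > 0" and len: "integral {-s..s} (\<lambda>v. 1 / (k * arc_height k a v)) = 2 * L"
    using ex_arc_of_length[OF assms] .
  define w where "w v = 1 / (k * arc_height k a v)" for v
  \<comment> \<open>The arc is prolonged to slopes in \<open>(-s', s')\<close>, so that the ends \<open>\<plusminus>L\<close> are interior points and
    the inverse function theorem gives two-sided derivatives there.\<close>
  define s' where "s' = (1 + s) / 2"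
  have s': "s < s'" "s' < 1" using assms by (auto simp: s'_def)
  have w_pos: "w v > 0" if "v \<in> {-s'..s'}" for v
    using arc_height_pos[OF assms(1) a, of v] that s' assms by (auto simp: w_def)
  have cw: "continuous_on {-s'..s'} w"
  proof -
    have "continuous_on {-s'..s'} (arc_height k a)" unfolding arc_height_def by (intro continuous_intros)
    moreover have "\<forall>v\<in>{-s'..s'}. k * arc_height k a v \<noteq> 0" using w_pos unfolding w_def
      by (metis div_by_0 less_irrefl)
    ultimately show ?thesis unfolding w_def by (intro continuous_intros)
  qed
  define T where "T v = integral {-s'..v} w - integral {-s'..-s} w - L" for v
  have T': "(T has_real_derivative w v) (at v)" if "v \<in> {-s'<..<s'}" for v
  proof -
    have "((\<lambda>v. integral {-s'..v} w) has_real_derivative w v) (at v within {-s'..s'})"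
      by (rule integral_has_real_derivative[OF cw]) (use that in auto)
    then have "((\<lambda>v. integral {-s'..v} w) has_real_derivative w v) (at v)"
      using at_within_interior[of v "{-s'..s'}"] that by simp
    then show ?thesis unfolding T_def[abs_def] by (auto intro!: derivative_eq_intros)
  qed
  have TL: "T (-s) = - L" by (simp add: T_def)
  have "integral {-s'..-s} w + integral {-s..s} w = integral {-s'..s} w"
    by (rule Henstock_Kurzweil_Integration.integral_combine)
      (use s' assms in \<open>auto intro!: integrable_continuous_real continuous_on_subset[OF cw]\<close>)
  then have TR: "T s = L" using len by (simp add: T_def w_def[abs_def])
  have mono: "T v < T v'" if "-s' < v" "v < v'" "v' < s'" for v v'
  proof (rule DERIV_pos_imp_increasing[OF \<open>v < v'\<close>])
    fix x assume "v \<le> x" "x \<le> v'"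
    then have "x \<in> {-s'<..<s'}" using that by auto
    then show "\<exists>y. DERIV T x :> y \<and> 0 < y" using T' w_pos[of x] by auto
  qed
  have inj: "inj_on T {-s'<..<s'}"
    by (rule linorder_inj_onI) (use mono in \<open>auto simp: less_le\<close>)
  define u where "u = inv_into {-s'<..<s'} T"
  have uT: "u (T v) = v" if "v \<in> {-s'<..<s'}" for v
    unfolding u_def by (rule inv_into_f_f[OF inj that])
  have cT: "isCont T v" if "v \<in> {-s'<..<s'}" for v using T'[OF that] by (rule DERIV_isCont)
  define r where "r = (s + s') / 2"
  have r: "s < r" "r < s'" using s' by (auto simp: r_def)
  have range: "\<exists>v. v \<in> {-r..r} \<and> T v = x" if "T (-r) \<le> x" "x \<le> T r" for x
  proof -
    have "\<exists>v\<ge>-r. v \<le> r \<and> T v = x"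
      by (rule IVT) (use that r assms cT in auto)
    then show ?thesis by auto
  qed
  have rL: "T (-r) < -L" "L < T r" using mono[of "-r" "-s"] mono[of s r] r s' assms TL TR by auto
  have u': "(u has_real_derivative k * arc_height k a (u x)) (at x) \<and> \<bar>u x\<bar> < 1" if "x \<in> {-L..L}" for x
  proof -
    obtain v where v: "v \<in> {-r..r}" "T v = x" 
    proof -
      have "T (-r) \<le> x" "x \<le> T r" using \<open>x \<in> {-L..L}\<close> rL by auto
      then show thesis using range that by blast
    qed
    have "u x = v" using uT[of v] v r by auto
    have "v \<noteq> r" "v \<noteq> -r" using v rL that by auto
    then have v': "-r < v" "v < r" using v by auto
    have "isCont u (T v)"
    proof (rule isCont_inverse_function2[of "-r" v r u T])
      show "u (T z) = z" if "-r \<le> z" "z \<le> r" for z using uT[of z] that r by auto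
      show "isCont T z" if "-r \<le> z" "z \<le> r" for z using cT[of z] that r by auto
    qed (use v' in auto)
    then have c: "isCont u x" using v by simp
    have "(u has_real_derivative inverse (w v)) (at x)"
    proof (rule DERIV_inverse_function[of T "w v" u x "T (-r)" "T r"])
      show "DERIV T (u x) :> w v" using T'[of v] \<open>u x = v\<close> v' r by auto
      show "w v \<noteq> 0" using w_pos[of v] v' r by auto
      show "T (u y) = y" if y: "T (-r) < y" "y < T r" for y
      proof -
        obtain z where "z \<in> {-r..r}" "T z = y" using range[of y] y by auto
        then show ?thesis using uT[of z] r by auto
      qed
    qed (use rL that c in auto)
    then show ?thesis using \<open>u x = v\<close> v' r s' by (auto simp: w_def)
  qed
  define \<eta> where "\<eta> x = arc_height k a (u x)" for x
  have "(\<eta> has_real_derivative u x / sqrt (1 - (u x)\<^sup>2)) (at x)" if "x \<in> {-L..L}" for x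
  proof -
    have ux: "\<bar>u x\<bar> < 1" using u'[OF that] by simp
    have "(\<eta> has_real_derivative
        u x / sqrt (1 - (u x)\<^sup>2) / (k * arc_height k a (u x)) * (k * arc_height k a (u x))) (at x)"
      unfolding \<eta>_def[abs_def]
      by (rule DERIV_chain2[where g = u, OF arc_height_has_derivative[OF assms(1) a ux]]) (use u'[OF that] in simp)
    then show ?thesis using arc_height_pos[OF assms(1) a ux] assms by simp
  qed
  moreover have "u L = s" "u (-L) = -s" using uT[of s] uT[of "-s"] TL TR s' assms by auto
  ultimately show ?thesis using that[of \<eta> u] u' by (auto simp: \<eta>_def)
qed

text \<open>Reflection \<open>(\<eta>, u) \<mapsto> (-\<eta>, -u)\<close> reduces negative \<open>s\<close> to positive \<open>s\<close>; for \<open>s = 0\<close> the profile is flat.\<close>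
lemma ex_arc_profile:
  assumes "k > 0" "\<bar>s\<bar> < 1" "L > 0"
  obtains \<eta> u where
    "\<And>x. x \<in> {-L..L} \<Longrightarrow> (\<eta> has_real_derivative u x / sqrt (1 - (u x)\<^sup>2)) (at x)"
    "\<And>x. x \<in> {-L..L} \<Longrightarrow> (u has_real_derivative k * \<eta> x) (at x)"
    "\<And>x. x \<in> {-L..L} \<Longrightarrow> \<bar>u x\<bar> < 1" "u L = s" "u (-L) = -s"
proof -
  consider "s = 0" | "s > 0" | "s < 0" by linarith
  then show ?thesis
  proof cases
    case 1
    then show ?thesis using that[of "\<lambda>x. 0" "\<lambda>x. 0"] by simp
  next
    case 2
    then show ?thesis using ex_arc_profile_pos[of k s L] assms that by auto
  next
    case 3
    then obtain \<eta> u where *: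
      "\<And>x. x \<in> {-L..L} \<Longrightarrow> (\<eta> has_real_derivative u x / sqrt (1 - (u x)\<^sup>2)) (at x)"
      "\<And>x. x \<in> {-L..L} \<Longrightarrow> (u has_real_derivative k * \<eta> x) (at x)"
      "\<And>x. x \<in> {-L..L} \<Longrightarrow> \<bar>u x\<bar> < 1" "u L = -s" "u (-L) = s"
      using ex_arc_profile_pos[of k "-s" L] assms by auto
    show ?thesis
    proof (rule that[of "\<lambda>x. - \<eta> x" "\<lambda>x. - u x"])
      fix x assume x: "x \<in> {-L..L}"
      show "((\<lambda>x. - \<eta> x) has_real_derivative - u x / sqrt (1 - (- u x)\<^sup>2)) (at x)"
        using DERIV_minus[OF *(1)[OF x]] by simp
      show "((\<lambda>x. - u x) has_real_derivative k * - \<eta> x) (at x)"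
        using DERIV_minus[OF *(2)[OF x]] by simp
    qed (use * in auto)
  qed
qed

lemma diff_times_SucI:
  "(\<And>x. x \<in> S \<Longrightarrow> (f has_real_derivative f' x) (at x within S)) \<Longrightarrow> diff_times S n f' \<Longrightarrow> diff_times S (Suc n) f"
  by auto

text \<open>With \<open>w = 1 / sqrt (1 - u\<^sup>2)\<close> the system reads \<open>\<eta>' = u w\<close>, \<open>u' = k \<eta>\<close>, \<open>w' = k \<eta> u w\<^sup>3\<close>.  Its right-hand
  sides are polynomials, so each order of differentiability of \<open>(\<eta>, u, w)\<close> yields the next one.\<close>
lemma arc_profile_diff_times:
  assumes \<eta>: "\<And>x. x \<in> S \<Longrightarrow> (\<eta> has_real_derivative u x / sqrt (1 - (u x)\<^sup>2)) (at x within S)"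
    and u: "\<And>x. x \<in> S \<Longrightarrow> (u has_real_derivative k * \<eta> x) (at x within S)"
    and u1: "\<And>x. x \<in> S \<Longrightarrow> \<bar>u x\<bar> < 1"
  shows "diff_times S n \<eta>"
proof -
  define w where "w x = 1 / sqrt (1 - (u x)\<^sup>2)" for x
  have w: "(w has_real_derivative u x * (w x * (w x * w x)) * (k * \<eta> x)) (at x within S)" if "x \<in> S" for x
  proof -
    note b = sqrt_one_minus_bounds[OF u1[OF that]]
    have "((\<lambda>x. 1 - (u x)\<^sup>2) has_real_derivative - (2 * u x * (k * \<eta> x))) (at x within S)"
      by (auto intro!: derivative_eq_intros u[OF that])
    from DERIV_chain2[OF DERIV_real_sqrt this] b(1)
    have "((\<lambda>x. sqrt (1 - (u x)\<^sup>2)) has_real_derivative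
        inverse (sqrt (1 - (u x)\<^sup>2)) / 2 * - (2 * u x * (k * \<eta> x))) (at x within S)" by simp
    from DERIV_inverse'[OF this] b(2)
    have "((\<lambda>x. inverse (sqrt (1 - (u x)\<^sup>2))) has_real_derivative
       - (inverse (sqrt (1 - (u x)\<^sup>2)) * (inverse (sqrt (1 - (u x)\<^sup>2)) / 2 * - (2 * u x * (k * \<eta> x))) *
         inverse (sqrt (1 - (u x)\<^sup>2)))) (at x within S)" by simp
    then show ?thesis by (simp add: w_def[abs_def] inverse_eq_divide mult_ac)
  qed
  have "diff_times S n \<eta> \<and> diff_times S n u \<and> diff_times S n w"
  proof (induction n)
    case (Suc n)
    then have *: "diff_times S n (\<lambda>x. u x * w x)" "diff_times S n (\<lambda>x. k * \<eta> x)"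
      "diff_times S n (\<lambda>x. u x * (w x * (w x * w x)) * (k * \<eta> x))"
      by (auto intro!: diff_times_mult diff_times_const)
    have "(\<eta> has_real_derivative u x * w x) (at x within S)" if "x \<in> S" for x
      using \<eta>[OF that] by (simp add: w_def)
    from diff_times_SucI[OF this *(1)] diff_times_SucI[OF u *(2)] diff_times_SucI[OF w *(3)]
    show ?case by (intro conjI)
  qed simp
  then show ?thesis by simp
qed

section \<open>Convexity of the arc length integrand\<close>

text \<open>The tangent inequality is the Cauchy-Schwarz inequality for \<open>(1, p)\<close> and \<open>(1, q)\<close>.\<close>
lemma sqrt_graph_convex:
  fixes p q :: real
  shows "sqrt (1 + p\<^sup>2) \<ge> sqrt (1 + q\<^sup>2) + q / sqrt (1 + q\<^sup>2) * (p - q)"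
proof -
  have q: "sqrt (1 + q\<^sup>2) > 0" by (simp add: add_pos_nonneg)
  have "1 + p * q \<le> sqrt ((1 + p\<^sup>2) * (1 + q\<^sup>2))"
  proof (rule real_le_rsqrt)
    have "(1 + p\<^sup>2) * (1 + q\<^sup>2) - (1 + p * q)\<^sup>2 = (p - q)\<^sup>2" by (simp add: power2_eq_square algebra_simps)
    then show "(1 + p * q)\<^sup>2 \<le> (1 + p\<^sup>2) * (1 + q\<^sup>2)" by (smt (verit) zero_le_power2)
  qed
  then have "1 + p * q \<le> sqrt (1 + p\<^sup>2) * sqrt (1 + q\<^sup>2)" by (simp add: real_sqrt_mult)
  then have "(1 + p * q) / sqrt (1 + q\<^sup>2) \<le> sqrt (1 + p\<^sup>2)" using q by (simp add: pos_divide_le_eq)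
  moreover have "sqrt (1 + q\<^sup>2) + q / sqrt (1 + q\<^sup>2) * (p - q) = (1 + p * q) / sqrt (1 + q\<^sup>2)"
  proof -
    have "sqrt (1 + q\<^sup>2) = (1 + q\<^sup>2) / sqrt (1 + q\<^sup>2)" by (simp add: real_div_sqrt)
    then have "sqrt (1 + q\<^sup>2) + q / sqrt (1 + q\<^sup>2) * (p - q) = (1 + q\<^sup>2) / sqrt (1 + q\<^sup>2) + q * (p - q) / sqrt (1 + q\<^sup>2)"
      by simp
    also have "\<dots> = (1 + p * q) / sqrt (1 + q\<^sup>2)"
      unfolding add_divide_distrib[symmetric] by (simp add: power2_eq_square algebra_simps)
    finally show ?thesis .
  qed
  ultimately show ?thesis by simp
qed

lemma unit_slope_strict_mono:
  fixes p q :: real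
  assumes "p < q" shows "p / sqrt (1 + p\<^sup>2) < q / sqrt (1 + q\<^sup>2)"
proof -
  have "((\<lambda>p. p / sqrt (1 + p\<^sup>2)) has_real_derivative 1 / (sqrt (1 + x\<^sup>2) * (1 + x\<^sup>2))) (at x)" for x :: real
  proof -
    have *: "1 + x\<^sup>2 > 0" by (simp add: add_pos_nonneg)
    have sq: "sqrt (1 + x\<^sup>2) * sqrt (1 + x\<^sup>2) = 1 + x\<^sup>2" using * by simp
    have "((\<lambda>p. p / sqrt (1 + p\<^sup>2)) has_real_derivative
       (1 * sqrt (1 + x\<^sup>2) - x * (2 * x * (inverse (sqrt (1 + x\<^sup>2)) / 2))) / (sqrt (1 + x\<^sup>2) * sqrt (1 + x\<^sup>2))) (at x)"
      using * by (auto intro!: derivative_eq_intros)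
    moreover have "1 * sqrt (1 + x\<^sup>2) - x * (2 * x * (inverse (sqrt (1 + x\<^sup>2)) / 2)) = 1 / sqrt (1 + x\<^sup>2)"
    proof -
      have "(1 * sqrt (1 + x\<^sup>2) - x * (2 * x * (inverse (sqrt (1 + x\<^sup>2)) / 2))) * sqrt (1 + x\<^sup>2) = 1"
        using * sq by (simp add: left_diff_distrib mult.assoc power2_eq_square)
      then show ?thesis using * by (simp add: eq_divide_eq)
    qed
    ultimately show ?thesis using sq by simp
  qed
  moreover have "1 / (sqrt (1 + x\<^sup>2) * (1 + x\<^sup>2)) > 0" for x :: real
    by (auto intro!: divide_pos_pos mult_pos_pos add_pos_nonneg)
  ultimately show ?thesis using DERIV_pos_imp_increasing[OF assms] by blast
qed

lemma unit_slope_diff_mult_nonneg: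
  fixes p q :: real
  shows "(p / sqrt (1 + p\<^sup>2) - q / sqrt (1 + q\<^sup>2)) * (p - q) \<ge> 0"
  using unit_slope_strict_mono[of p q] unit_slope_strict_mono[of q p]
  by (cases p q rule: linorder_cases) (auto intro: mult_nonpos_nonpos mult_nonneg_nonneg)

section \<open>Uniqueness\<close>

lemma at_within_segment_nontrivial:
  assumes "l > 0" "x \<in> {-l..l}" shows "at x within {-l..l::real} \<noteq> bot"
  using assms by (simp add: trivial_limit_within islimpt_Icc)

lemma smooth_slope_derivatives:
  assumes "l > 0" "smooth_on {-l..l} \<zeta>" "x \<in> {-l..l}"
  shows "(\<zeta> has_real_derivative deriv_on {-l..l} \<zeta> x) (at x within {-l..l})"
    "(unit_slope {-l..l} \<zeta> has_real_derivative curvature_op {-l..l} \<zeta> x) (at x within {-l..l})"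
proof -
  let ?S = "{-l..l}"
  have d: "\<zeta> differentiable (at x within ?S)" "deriv_on ?S \<zeta> differentiable (at x within ?S)"
    using assms(2)[unfolded smooth_on_def, rule_format, of x 0]
      assms(2)[unfolded smooth_on_def, rule_format, of x 1] assms(3) by auto
  show "(\<zeta> has_real_derivative deriv_on ?S \<zeta> x) (at x within ?S)" by (rule deriv_on_has_derivative[OF d(1)])
  have "1 + \<bar>deriv_on ?S \<zeta> x\<bar>\<^sup>2 > 0" by (simp add: add_pos_nonneg)
  moreover obtain D where D: "(deriv_on ?S \<zeta> has_real_derivative D) (at x within ?S)"
    using deriv_on_has_derivative[OF d(2)] by blast
  ultimately have "\<exists>D. (unit_slope ?S \<zeta> has_real_derivative D) (at x within ?S)"
    unfolding unit_slope_def[abs_def] power2_abs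
    by (intro exI) (auto intro!: derivative_eq_intros D)
  then show "(unit_slope ?S \<zeta> has_real_derivative curvature_op ?S \<zeta> x) (at x within ?S)"
    unfolding curvature_op_def
    by (metis deriv_on_eq at_within_segment_nontrivial[OF assms(1,3)])
qed

text \<open>The function \<open>E\<close> below is nondecreasing and vanishes at both ends, so its derivative, which
  dominates \<open>(g / \<sigma>) (\<zeta>1 - \<zeta>2)\<^sup>2\<close>, is zero in the interior.\<close>
lemma capillary_bvp_unique:
  assumes pos: "g > 0" "\<sigma> > 0" "l > 0"
    and s1: "smooth_on {-l..l} \<zeta>1" "capillary_bvp g \<sigma> \<gamma> l P \<zeta>1"
    and s2: "smooth_on {-l..l} \<zeta>2" "capillary_bvp g \<sigma> \<gamma> l P \<zeta>2"
    and "x \<in> {-l..l}"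
  shows "\<zeta>1 x = \<zeta>2 x"
proof -
  let ?S = "{-l..l}"
  define q1 q2 where "q1 = deriv_on ?S \<zeta>1" and "q2 = deriv_on ?S \<zeta>2"
  define u1 u2 where "u1 = unit_slope ?S \<zeta>1" and "u2 = unit_slope ?S \<zeta>2"
  define c1 c2 where "c1 = curvature_op ?S \<zeta>1" and "c2 = curvature_op ?S \<zeta>2"
  have d: "(\<zeta>1 has_real_derivative q1 x) (at x within ?S)" "(\<zeta>2 has_real_derivative q2 x) (at x within ?S)"
    "(u1 has_real_derivative c1 x) (at x within ?S)" "(u2 has_real_derivative c2 x) (at x within ?S)"
    if "x \<in> ?S" for x
    unfolding q1_def q2_def u1_def u2_def c1_def c2_def
    using smooth_slope_derivatives[OF pos(3) s1(1) that] smooth_slope_derivatives[OF pos(3) s2(1) that] by auto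
  define E where "E x = (u1 x - u2 x) * (\<zeta>1 x - \<zeta>2 x)" for x
  have dE: "(E has_real_derivative (c1 x - c2 x) * (\<zeta>1 x - \<zeta>2 x) + (q1 x - q2 x) * (u1 x - u2 x)) (at x within ?S)"
    if "x \<in> ?S" for x
    unfolding E_def[abs_def] by (intro DERIV_mult DERIV_diff d that)
  have ode: "\<sigma> * (c1 x - c2 x) = g * (\<zeta>1 x - \<zeta>2 x)" if "x \<in> {-l<..<l}" for x
    using s1(2) s2(2) that unfolding capillary_bvp_def c1_def c2_def by (auto simp: algebra_simps)
  have dE_ge: "(c1 x - c2 x) * (\<zeta>1 x - \<zeta>2 x) + (q1 x - q2 x) * (u1 x - u2 x) \<ge> g / \<sigma> * (\<zeta>1 x - \<zeta>2 x)\<^sup>2"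
    if "x \<in> {-l<..<l}" for x
  proof -
    have "c1 x - c2 x = g / \<sigma> * (\<zeta>1 x - \<zeta>2 x)" using ode[OF that] pos by (simp add: field_simps)
    moreover have "(u1 x - u2 x) * (q1 x - q2 x) \<ge> 0"
      using unit_slope_diff_mult_nonneg[of "q1 x" "q2 x"]
      by (simp add: u1_def u2_def unit_slope_def q1_def q2_def)
    ultimately show ?thesis by (simp add: power2_eq_square mult_ac)
  qed
  have cE: "continuous_on ?S E" by (rule DERIV_continuous_on[OF dE])
  have bd: "u1 l = u2 l" "u1 (-l) = u2 (-l)"
    using s1(2) s2(2) pos unfolding capillary_bvp_def u1_def u2_def by (metis mult_cancel_left less_irrefl)+
  have E0: "E l = 0" "E (-l) = 0" by (auto simp: E_def bd)
  have interior: "at x within ?S = at x" if "x \<in> {-l<..<l}" for x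
    by (rule at_within_interior) (use that in auto)
  have mono: "E x \<le> E y" if "-l \<le> x" "x \<le> y" "y \<le> l" for x y
  proof (rule DERIV_nonneg_imp_increasing_open[OF \<open>x \<le> y\<close>])
    show "continuous_on {x..y} E" by (rule continuous_on_subset[OF cE]) (use that in auto)
    fix z assume "x < z" "z < y"
    then have z: "z \<in> {-l<..<l}" using that by auto
    have "0 \<le> g / \<sigma> * (\<zeta>1 z - \<zeta>2 z)\<^sup>2" using pos by simp
    then show "\<exists>y. DERIV E z :> y \<and> 0 \<le> y"
      using dE[of z] order_trans[OF _ dE_ge[OF z]] z interior[OF z] by auto
  qed
  have Ezero: "E x = 0" if "x \<in> ?S" for x
    using mono[of "-l" x] mono[of x l] E0 that by auto
  have eq: "\<zeta>1 x = \<zeta>2 x" if x: "x \<in> {-l<..<l}" for x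
  proof -
    have "((\<lambda>_. 0) has_real_derivative (c1 x - c2 x) * (\<zeta>1 x - \<zeta>2 x) + (q1 x - q2 x) * (u1 x - u2 x)) (at x)"
      by (rule has_field_derivative_transform_within_open[of E _ _ "{-l<..<l}"])
        (use dE[of x] interior[OF x] x Ezero in auto)
    then have "(c1 x - c2 x) * (\<zeta>1 x - \<zeta>2 x) + (q1 x - q2 x) * (u1 x - u2 x) = 0"
      using DERIV_unique[OF _ DERIV_const] by blast
    with dE_ge[OF x] have "g / \<sigma> * (\<zeta>1 x - \<zeta>2 x)\<^sup>2 \<le> 0" by simp
    then have "(\<zeta>1 x - \<zeta>2 x)\<^sup>2 \<le> 0" using pos by (simp add: mult_le_0_iff divide_le_0_iff)
    then show ?thesis by simp
  qed
  have "continuous_on ?S (\<lambda>x. \<zeta>1 x - \<zeta>2 x)"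
    by (intro continuous_on_diff DERIV_continuous_on[OF d(1)] DERIV_continuous_on[OF d(2)])
  moreover have "closure {-l<..<l} = ?S" using pos by simp
  ultimately have "\<zeta>1 x - \<zeta>2 x = 0"
    using continuous_constant_on_closure[of "{-l<..<l}" "\<lambda>x. \<zeta>1 x - \<zeta>2 x" 0 x] eq \<open>x \<in> ?S\<close> by auto
  then show ?thesis by simp
qed


section \<open>Minimality\<close>

text \<open>The weak form of the boundary value problem: the first variation of the energy at \<open>\<zeta>\<close> in the
  direction \<open>v\<close> is \<open>P\<close> times the mass of \<open>v\<close>.  Unlike test functions, \<open>v\<close> need not vanish at the ends;
  the boundary values of \<open>u\<close> produce the wetting term.\<close>
lemma capillary_natural_boundary:
  assumes pos: "g > 0" "\<sigma> > 0" "l > 0"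
    and u: "\<And>x. x \<in> {-l..l} \<Longrightarrow> (u has_real_derivative (g * \<zeta> x - P) / \<sigma>) (at x within {-l..l})"
    and bc: "\<sigma> * u l = \<gamma>" "\<sigma> * u (-l) = - \<gamma>"
    and \<zeta>: "continuous_on {-l..l} \<zeta>"
    and p: "set_integrable lebesgue {-l<..<l} p"
    and v: "\<And>x. x \<in> {-l..l} \<Longrightarrow> v x = C + primitive (-l) p x"
  shows "\<sigma> * (LINT x:{-l<..<l}|lebesgue. p x * u x) + (LINT x:{-l<..<l}|lebesgue. v x * (g * \<zeta> x - P))
    = \<gamma> * (v l + v (-l))"
proof -
  let ?U = "{-l<..<l}"
  define w where "w x = (g * \<zeta> x - P) / \<sigma>" for x
  have cw: "continuous_on {-l..l} w" unfolding w_def using pos by (intro continuous_intros \<zeta>) auto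
  have parts: "(LINT x:?U|lebesgue. primitive (-l) p x * w x)
      = u l * primitive (-l) p l - (LINT x:?U|lebesgue. p x * u x)"
    by (rule integral_by_parts_primitive[OF _ p]) (use pos u cw in \<open>auto simp: w_def\<close>)
  have ftc: "(LINT x:?U|lebesgue. w x) = u l - u (-l)"
    by (rule set_integral_FTC) (use pos u cw in \<open>auto simp: w_def\<close>)
  have i: "set_integrable lebesgue ?U w" "set_integrable lebesgue ?U (\<lambda>x. primitive (-l) p x * w x)"
    by (auto intro!: set_integrable_continuous continuous_intros cw primitive_continuous p)
  have "(LINT x:?U|lebesgue. v x * (g * \<zeta> x - P))
      = (LINT x:?U|lebesgue. \<sigma> * (C * w x + primitive (-l) p x * w x))"
  proof (rule set_lebesgue_integral_cong)
    have "g * \<zeta> x - P = \<sigma> * w x" for x using pos by (simp add: w_def)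
    then show "\<forall>x. x \<in> ?U \<longrightarrow> v x * (g * \<zeta> x - P) = \<sigma> * (C * w x + primitive (-l) p x * w x)"
      by (auto simp: v algebra_simps)
  qed simp
  also have "\<dots> = \<sigma> * (C * (u l - u (-l)) + (u l * primitive (-l) p l - (LINT x:?U|lebesgue. p x * u x)))"
    using i by (simp add: set_integral_add parts ftc)
  also have "\<dots> = \<gamma> * (C + C + primitive (-l) p l) - \<sigma> * (LINT x:?U|lebesgue. p x * u x)"
  proof -
    have "\<sigma> * (C * (A - B) + (A * R - I)) = \<gamma> * (C + C + R) - \<sigma> * I"
      if "\<sigma> * A = \<gamma>" "\<sigma> * B = - \<gamma>" for A B R I
    proof -
      have "\<sigma> * (C * (A - B) + (A * R - I)) = C * (\<sigma> * A) - C * (\<sigma> * B) + (\<sigma> * A) * R - \<sigma> * I"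
        by (simp add: algebra_simps)
      also have "\<dots> = \<gamma> * (C + C + R) - \<sigma> * I" unfolding that by (simp add: algebra_simps)
      finally show ?thesis .
    qed
    then show ?thesis using bc by blast
  qed
  finally have "\<sigma> * (LINT x:?U|lebesgue. p x * u x) + (LINT x:?U|lebesgue. v x * (g * \<zeta> x - P))
      = \<gamma> * (C + C + primitive (-l) p l)" by simp
  moreover have "v l = C + primitive (-l) p l" "v (-l) = C"
    using v[of l] v[of "-l"] pos by (auto simp: primitive_def set_lebesgue_integral_def)
  ultimately show ?thesis by (simp add: algebra_simps)
qed

text \<open>The weak form is applied both to the competitor \<open>v\<close> and to \<open>\<zeta>\<close> itself; the difference of the two
  identities is the linear part of the energy difference.\<close>
lemma capillary_energy_minimal:
  assumes pos: "g > 0" "\<sigma> > 0" "l > 0"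
    and \<zeta>: "\<And>x. x \<in> {-l..l} \<Longrightarrow> (\<zeta> has_real_derivative q x) (at x within {-l..l})"
    and q: "continuous_on {-l..l} q"
    and u: "\<And>x. x \<in> {-l..l} \<Longrightarrow> (u has_real_derivative (g * \<zeta> x - P) / \<sigma>) (at x within {-l..l})"
    and uq: "\<And>x. x \<in> {-l..l} \<Longrightarrow> u x = q x / sqrt (1 + (q x)\<^sup>2)"
    and bc: "\<sigma> * u l = \<gamma>" "\<sigma> * u (-l) = - \<gamma>"
    and \<psi>: "\<psi> \<in> W11 {-l<..<l}"
    and mass: "(LINT x:{-l<..<l}|lebesgue. \<psi> x) = (LINT x:{-l<..<l}|lebesgue. \<zeta> x)"
  shows "energy g \<sigma> \<gamma> l \<zeta> \<le> energy g \<sigma> \<gamma> l \<psi>"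
proof -
  let ?U = "{-l<..<l}"
  have ll: "-l < l" using pos by simp
  have c\<zeta>: "continuous_on {-l..l} \<zeta>" by (rule DERIV_continuous_on[OF \<zeta>])
  have cu: "continuous_on {-l..l} u" by (rule DERIV_continuous_on[OF u])
  have iq: "set_integrable lebesgue ?U q" by (rule set_integrable_continuous[OF q])
  have wq: "has_weak_deriv ?U \<zeta> q" by (rule has_weak_deriv_C1[OF ll \<zeta> q])
  have "\<zeta> \<in> W11 ?U" using iq wq set_integrable_continuous[OF c\<zeta>] by (auto simp: W11_def)
  then have q_ae: "AE x in lebesgue. x \<in> ?U \<longrightarrow> weak_deriv ?U \<zeta> x = q x"
    using W11_representation[OF ll] weak_deriv_unique[OF _ _ iq wq] by metis
  have \<zeta>_prim: "\<zeta> x = \<zeta> (-l) + primitive (-l) q x" if "x \<in> {-l..l}" for x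
    unfolding primitive_def
    by (subst set_integral_FTC[of "-l" x \<zeta> q])
      (use that in \<open>auto intro: has_field_derivative_subset[OF \<zeta>] continuous_on_subset[OF q]\<close>)
  define p where "p = weak_deriv ?U \<psi>"
  obtain C where p: "set_integrable lebesgue ?U p"
    and \<psi>_ae: "AE x in lebesgue. x \<in> ?U \<longrightarrow> \<psi> x = C + primitive (-l) p x"
    using W11_representation[OF ll \<psi>] unfolding p_def by metis
  define v where "v x = C + primitive (-l) p x" for x
  have cv: "continuous_on {-l..l} v" unfolding v_def by (intro continuous_intros primitive_continuous p)
  have ae\<psi>: "AE x in lebesgue. x \<in> ?U \<longrightarrow> \<psi> x = v x" using \<psi>_ae by (simp add: v_def)
  have I\<zeta>: "set_integrable lebesgue ?U (\<lambda>x. g / 2 * (\<zeta> x)\<^sup>2 + \<sigma> * sqrt (1 + (q x)\<^sup>2))"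
    "energy g \<sigma> \<gamma> l \<zeta> = ereal ((LINT x:?U|lebesgue. g / 2 * (\<zeta> x)\<^sup>2 + \<sigma> * sqrt (1 + (q x)\<^sup>2)) - \<gamma> * (\<zeta> l + \<zeta> (-l)))"
    using energy_eq[OF pos c\<zeta> _ iq q_ae] by auto
  have I\<psi>: "set_integrable lebesgue ?U (\<lambda>x. g / 2 * (v x)\<^sup>2 + \<sigma> * sqrt (1 + (p x)\<^sup>2))"
    "energy g \<sigma> \<gamma> l \<psi> = ereal ((LINT x:?U|lebesgue. g / 2 * (v x)\<^sup>2 + \<sigma> * sqrt (1 + (p x)\<^sup>2)) - \<gamma> * (v l + v (-l)))"
    using energy_eq[OF pos cv ae\<psi> p] by (auto simp: p_def)
  have iv: "set_integrable lebesgue ?U (\<lambda>x. v x * (g * \<zeta> x - P))" "set_integrable lebesgue ?U (\<lambda>x. \<zeta> x * (g * \<zeta> x - P))"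
      "set_integrable lebesgue ?U v" "set_integrable lebesgue ?U \<zeta>"
    by (auto intro!: set_integrable_continuous continuous_intros cv c\<zeta>)
  have ip: "set_integrable lebesgue ?U (\<lambda>x. p x * u x)" "set_integrable lebesgue ?U (\<lambda>x. q x * u x)"
    using set_integrable_mult_continuous p iq cu by auto
  have mass': "(LINT x:?U|lebesgue. v x) = (LINT x:?U|lebesgue. \<zeta> x)"
  proof -
    have "(LINT x:?U|lebesgue. \<psi> x) = (LINT x:?U|lebesgue. v x)"
      unfolding set_lebesgue_integral_def
    proof (rule integral_cong_AE)
      show "(\<lambda>x. indicator ?U x *\<^sub>R \<psi> x) \<in> borel_measurable lebesgue"
        using \<psi> by (auto simp: W11_def set_integrable_def)
      show "(\<lambda>x. indicator ?U x *\<^sub>R v x) \<in> borel_measurable lebesgue"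
        using iv(3) by (auto simp: set_integrable_def)
      show "AE x in lebesgue. indicator ?U x *\<^sub>R \<psi> x = indicator ?U x *\<^sub>R v x"
        using ae\<psi> by eventually_elim (auto simp: indicator_def)
    qed
    then show ?thesis using mass by simp
  qed
  \<comment> \<open>The tangent plane of the integrand at \<open>(\<zeta>, q)\<close>, evaluated at \<open>(v, p)\<close>.  The term \<open>g \<zeta> (v - \<zeta>)\<close> is
    split into a part matching the weak form and \<open>P (v - \<zeta>)\<close>, whose integral vanishes.\<close>
  let ?lin = "\<lambda>x. (g / 2 * (\<zeta> x)\<^sup>2 + \<sigma> * sqrt (1 + (q x)\<^sup>2)) + (v x * (g * \<zeta> x - P) - \<zeta> x * (g * \<zeta> x - P))
      + P * (v x - \<zeta> x) + \<sigma> * (p x * u x - q x * u x)"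
  have a: "set_integrable lebesgue ?U (\<lambda>x. v x * (g * \<zeta> x - P) - \<zeta> x * (g * \<zeta> x - P))"
    "set_integrable lebesgue ?U (\<lambda>x. P * (v x - \<zeta> x))"
    "set_integrable lebesgue ?U (\<lambda>x. \<sigma> * (p x * u x - q x * u x))"
    using iv ip by (auto intro!: set_integral_diff(1) set_integrable_mult_right)
  have lin: "set_integrable lebesgue ?U ?lin"
    by (rule set_integral_add(1)[OF set_integral_add(1)[OF set_integral_add(1)[OF I\<zeta>(1) a(1)] a(2)] a(3)])
  have "(LINT x:?U|lebesgue. ?lin x) \<le> (LINT x:?U|lebesgue. g / 2 * (v x)\<^sup>2 + \<sigma> * sqrt (1 + (p x)\<^sup>2))"
  proof (rule set_integral_mono[OF lin I\<psi>(1)])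
    fix x assume "x \<in> ?U"
    then have ux: "u x = q x / sqrt (1 + (q x)\<^sup>2)" using uq by auto
    have "\<sigma> * (sqrt (1 + (q x)\<^sup>2) + u x * (p x - q x)) \<le> \<sigma> * sqrt (1 + (p x)\<^sup>2)"
      unfolding ux using sqrt_graph_convex[of "q x" "p x"] pos by (intro mult_left_mono) auto
    moreover have "g / 2 * (v x)\<^sup>2 = g / 2 * (\<zeta> x)\<^sup>2 + g * \<zeta> x * (v x - \<zeta> x) + g / 2 * (v x - \<zeta> x)\<^sup>2"
      by (simp add: power2_eq_square field_simps)
    moreover have "g / 2 * (v x - \<zeta> x)\<^sup>2 \<ge> 0" using pos by simp
    ultimately show "?lin x \<le> g / 2 * (v x)\<^sup>2 + \<sigma> * sqrt (1 + (p x)\<^sup>2)"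
      by (simp add: algebra_simps)
  qed
  also have "(LINT x:?U|lebesgue. ?lin x) = (LINT x:?U|lebesgue. g / 2 * (\<zeta> x)\<^sup>2 + \<sigma> * sqrt (1 + (q x)\<^sup>2))
      + ((LINT x:?U|lebesgue. v x * (g * \<zeta> x - P)) - (LINT x:?U|lebesgue. \<zeta> x * (g * \<zeta> x - P)))
      + P * ((LINT x:?U|lebesgue. v x) - (LINT x:?U|lebesgue. \<zeta> x))
      + \<sigma> * ((LINT x:?U|lebesgue. p x * u x) - (LINT x:?U|lebesgue. q x * u x))"
    using set_integral_add(2)[OF set_integral_add(1)[OF set_integral_add(1)[OF I\<zeta>(1) a(1)] a(2)] a(3)]
        set_integral_add(2)[OF set_integral_add(1)[OF I\<zeta>(1) a(1)] a(2)]
        set_integral_add(2)[OF I\<zeta>(1) a(1)] set_integral_diff(2)[OF iv(1,2)] set_integral_diff(2)[OF iv(3,4)]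
        set_integral_diff(2)[OF ip] by simp
  finally have main: "(LINT x:?U|lebesgue. g / 2 * (\<zeta> x)\<^sup>2 + \<sigma> * sqrt (1 + (q x)\<^sup>2))
      + ((LINT x:?U|lebesgue. v x * (g * \<zeta> x - P)) - (LINT x:?U|lebesgue. \<zeta> x * (g * \<zeta> x - P)))
      + \<sigma> * ((LINT x:?U|lebesgue. p x * u x) - (LINT x:?U|lebesgue. q x * u x))
      \<le> (LINT x:?U|lebesgue. g / 2 * (v x)\<^sup>2 + \<sigma> * sqrt (1 + (p x)\<^sup>2))"
    by (simp add: mass')
  have "\<sigma> * (LINT x:?U|lebesgue. p x * u x) + (LINT x:?U|lebesgue. v x * (g * \<zeta> x - P)) = \<gamma> * (v l + v (-l))"
    by (rule capillary_natural_boundary[OF pos u bc c\<zeta> p]) (auto simp: v_def)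
  moreover have "\<sigma> * (LINT x:?U|lebesgue. q x * u x) + (LINT x:?U|lebesgue. \<zeta> x * (g * \<zeta> x - P)) = \<gamma> * (\<zeta> l + \<zeta> (-l))"
    by (rule capillary_natural_boundary[OF pos u bc c\<zeta> iq]) (auto intro: \<zeta>_prim)
  ultimately show ?thesis using main unfolding I\<zeta>(2) I\<psi>(2) by (simp add: right_diff_distrib)
qed

section \<open>The capillary surface of given mass\<close>

theorem theorem1p1:
  fixes g \<sigma> l \<gamma> :: real
  assumes "g > 0" and "\<sigma> > 0" and "l > 0" and "\<bar>\<gamma>\<bar> / \<sigma> < 1"
  shows "\<exists>M_min\<ge>0. \<forall>M_top>M_min.
    let P0 = (g * M_top - 2 * \<gamma>) / (2 * l);
        sol = (\<lambda>\<zeta>. smooth_on {-l..l} \<zeta> \<and> capillary_bvp g \<sigma> \<gamma> l P0 \<zeta> \<and>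
                 (LINT x:{-l<..<l}|lebesgue. \<zeta> x) = M_top)
    in \<exists>\<zeta>0. sol \<zeta>0 \<and>
         (\<forall>\<eta>. sol \<eta> \<longrightarrow> (\<forall>x\<in>{-l..l}. \<eta> x = \<zeta>0 x)) \<and>
         (\<exists>x\<in>{-l..l}. (\<forall>y\<in>{-l..l}. \<zeta>0 x \<le> \<zeta>0 y) \<and> \<zeta>0 x > 0) \<and>
         (\<forall>\<psi>\<in>W11 {-l<..<l}. (LINT x:{-l<..<l}|lebesgue. \<psi> x) = M_top \<longrightarrow>
            energy g \<sigma> \<gamma> l \<zeta>0 \<le> energy g \<sigma> \<gamma> l \<psi>)"
proof -
  note pos = assms(1-3)
  let ?S = "{-l..l}"
  let ?U = "{-l<..<l}"
  have "\<bar>\<gamma> / \<sigma>\<bar> < 1" using assms by simp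
  then obtain \<eta> u where
      \<eta>: "\<And>x. x \<in> ?S \<Longrightarrow> (\<eta> has_real_derivative u x / sqrt (1 - (u x)\<^sup>2)) (at x)"
    and u: "\<And>x. x \<in> ?S \<Longrightarrow> (u has_real_derivative g / \<sigma> * \<eta> x) (at x)"
    and u1: "\<And>x. x \<in> ?S \<Longrightarrow> \<bar>u x\<bar> < 1" and ends: "u l = \<gamma> / \<sigma>" "u (-l) = - (\<gamma> / \<sigma>)"
    using ex_arc_profile[of "g / \<sigma>" "\<gamma> / \<sigma>" l] pos by auto
  note \<eta>S = has_field_derivative_at_within[OF \<eta>] and uS = has_field_derivative_at_within[OF u]
  have c\<eta>: "continuous_on ?S \<eta>" by (rule DERIV_continuous_on[OF \<eta>S])
  have cu: "continuous_on ?S u" by (rule DERIV_continuous_on[OF uS])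
  obtain x0 where x0: "x0 \<in> ?S" "\<And>y. y \<in> ?S \<Longrightarrow> \<eta> x0 \<le> \<eta> y"
    using continuous_attains_inf[OF _ _ c\<eta>] pos by auto
  define q where "q x = u x / sqrt (1 - (u x)\<^sup>2)" for x
  have cq: "continuous_on ?S q"
    unfolding q_def using sqrt_one_minus_bounds(2)[OF u1] by (intro continuous_intros cu) force
  have uq: "u x = q x / sqrt (1 + (q x)\<^sup>2)" if "x \<in> ?S" for x
  proof -
    note b = sqrt_one_minus_bounds[OF u1[OF that]]
    have "1 + (q x)\<^sup>2 = 1 / (1 - (u x)\<^sup>2)"
      using b by (simp add: q_def power_divide field_simps)
    then have "sqrt (1 + (q x)\<^sup>2) = 1 / sqrt (1 - (u x)\<^sup>2)" by (simp add: real_sqrt_divide)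
    then show ?thesis using b by (simp add: q_def)
  qed
  \<comment> \<open>\<open>M > 2 \<gamma> / g - 2 l min \<eta>\<close> is equivalent to \<open>min \<eta> + P / g > 0\<close>.\<close>
  show ?thesis
  proof (intro exI[of _ "max 0 (2 * \<gamma> / g - 2 * l * \<eta> x0)"] conjI allI impI)
    fix M assume M: "M > max 0 (2 * \<gamma> / g - 2 * l * \<eta> x0)"
    define P where "P = (g * M - 2 * \<gamma>) / (2 * l)"
    define \<zeta> where "\<zeta> x = \<eta> x + P / g" for x
    have \<zeta>': "(\<zeta> has_real_derivative q x) (at x within ?S)" if "x \<in> ?S" for x
      unfolding \<zeta>_def[abs_def] q_def using \<eta>S[OF that] by (auto intro!: derivative_eq_intros)
    have slope: "unit_slope ?S \<zeta> x = u x" if "x \<in> ?S" for x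
      unfolding unit_slope_def deriv_on_eq[OF at_within_segment_nontrivial[OF \<open>l > 0\<close> that] \<zeta>'[OF that]]
      using uq[OF that] by simp
    have curv: "curvature_op ?S \<zeta> x = g / \<sigma> * \<eta> x" if "x \<in> ?S" for x
      unfolding curvature_op_def
    proof (rule deriv_on_eq[OF at_within_segment_nontrivial[OF \<open>l > 0\<close> that]])
      show "(unit_slope ?S \<zeta> has_real_derivative g / \<sigma> * \<eta> x) (at x within ?S)"
        using uS[OF that, of ?S] unfolding has_field_derivative_def
        by (rule has_derivative_transform[where f = u, rotated 2]) (use that slope in auto)
    qed
    have "diff_times ?S n \<zeta>" for n
      unfolding \<zeta>_def
      by (intro diff_times_add diff_times_const arc_profile_diff_times[OF \<eta>S uS u1])
    then have smooth: "smooth_on ?S \<zeta>"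
      using smooth_on_iff_diff_times[OF at_within_segment_nontrivial[OF \<open>l > 0\<close>], of \<zeta>] by blast
    have bvp: "capillary_bvp g \<sigma> \<gamma> l P \<zeta>"
      unfolding capillary_bvp_def using pos by (auto simp: slope curv ends \<zeta>_def field_simps)
    have mass: "(LINT x:?U|lebesgue. \<zeta> x) = M"
    proof -
      have "((\<lambda>x. \<sigma> / g * u x + P / g * x) has_real_derivative \<zeta> x) (at x within ?S)" if "x \<in> ?S" for x
        using pos by (auto intro!: derivative_eq_intros uS[OF that] simp: \<zeta>_def)
      then have "(LINT x:?U|lebesgue. \<zeta> x) = (\<sigma> / g * u l + P / g * l) - (\<sigma> / g * u (-l) + P / g * (-l))"
        using pos by (intro set_integral_FTC DERIV_continuous_on[OF \<zeta>']) auto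
      also have "\<dots> = M" using pos by (simp add: ends P_def field_simps)
      finally show ?thesis .
    qed
    have "P / g = M / (2 * l) - \<gamma> / (l * g)" using pos by (simp add: P_def field_simps)
    moreover have "M / (2 * l) > (2 * \<gamma> / g - 2 * l * \<eta> x0) / (2 * l)"
      using M pos by (intro divide_strict_right_mono) auto
    moreover have "(2 * \<gamma> / g - 2 * l * \<eta> x0) / (2 * l) = \<gamma> / (l * g) - \<eta> x0"
      using pos by (simp add: field_simps)
    ultimately have "\<zeta> x0 > 0" by (simp add: \<zeta>_def)
    then have least: "\<exists>x\<in>?S. (\<forall>y\<in>?S. \<zeta> x \<le> \<zeta> y) \<and> \<zeta> x > 0"
      using x0 by (intro bexI[of _ x0]) (auto simp: \<zeta>_def)
    have minimal: "energy g \<sigma> \<gamma> l \<zeta> \<le> energy g \<sigma> \<gamma> l \<psi>"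
      if "\<psi> \<in> W11 ?U" "(LINT x:?U|lebesgue. \<psi> x) = M" for \<psi>
    proof (rule capillary_energy_minimal[OF pos \<zeta>' cq _ uq _ _ that(1)])
      show "(u has_real_derivative (g * \<zeta> x - P) / \<sigma>) (at x within ?S)" if "x \<in> ?S" for x
        using uS[OF that, of ?S] pos by (simp add: \<zeta>_def field_simps)
    qed (use pos that mass ends in auto)
    have unique: "\<zeta>' x = \<zeta> x" if "smooth_on ?S \<zeta>'" "capillary_bvp g \<sigma> \<gamma> l P \<zeta>'" "x \<in> ?S" for \<zeta>' x
      by (rule capillary_bvp_unique[OF pos that(1,2) smooth bvp that(3)])
    show "let P0 = (g * M - 2 * \<gamma>) / (2 * l);
        sol = (\<lambda>\<zeta>. smooth_on {-l..l} \<zeta> \<and> capillary_bvp g \<sigma> \<gamma> l P0 \<zeta> \<and>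
                 (LINT x:{-l<..<l}|lebesgue. \<zeta> x) = M)
    in \<exists>\<zeta>0. sol \<zeta>0 \<and>
         (\<forall>\<eta>. sol \<eta> \<longrightarrow> (\<forall>x\<in>{-l..l}. \<eta> x = \<zeta>0 x)) \<and>
         (\<exists>x\<in>{-l..l}. (\<forall>y\<in>{-l..l}. \<zeta>0 x \<le> \<zeta>0 y) \<and> \<zeta>0 x > 0) \<and>
         (\<forall>\<psi>\<in>W11 {-l<..<l}. (LINT x:{-l<..<l}|lebesgue. \<psi> x) = M \<longrightarrow>
            energy g \<sigma> \<gamma> l \<zeta>0 \<le> energy g \<sigma> \<gamma> l \<psi>)"
      unfolding Let_def P_def[symmetric]
      by (rule exI[of _ \<zeta>], intro conjI allI impI ballI)
        (fact smooth bvp mass least | (elim conjE, rule unique; assumption) | (rule minimal; assumption))+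
  qed simp
qed

end
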